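(* Let $p$ be a prime and $G=\mathbb{Z}\times\mathbb{Z}_p=\langle z\rangle\times\langle a\rangle$. Let $\mathcal{S}$ be a Schur ring over $G$, let $H$ be the maximal $\mathcal{S}$-subgroup contained in $\mathbb{Z}$, and write $T(\mathcal{S})=\mathcal{S}\cap F[\mathbb{Z}_p]=F[\mathbb{Z}_p]^{\mathcal{H}}$ with $\mathcal{H}\le\operatorname{Aut}(\mathbb{Z}_p)$ and $|\mathcal{H}|=m$. If there is an $\mathcal{S}$-class $C\subseteq G\setminus(H\times\mathbb{Z}_p)$ with $\gcd(|C|,m)=1$, then $\mathcal{S}$ is a wedge product or an automorphic Schur ring.
   Context: $F$ is a field of characteristic $0$; $\mathbb{Z}=\langle z\rangle$ infinite cyclic, $\mathbb{Z}_p=\langle a\rangle$ cyclic of order $p$, written multiplicatively. For finite $C\subseteq G$, $\overline{C}=\sum_{g\in C}g$ and $C^*=\{g^{-1}:g\in C\}$. A Schur ring over $G$ is a subspace $\mathcal{S}=\mathrm{Span}_F\{\overline{C}:C\in\mathcal{D}\}$ of $F[G]$, where $\mathcal{D}$ is a partition of $G$ into finite subsets with $\{1\}\in\mathcal{D}$, $C\in\mathcal{D}\Rightarrow C^*\in\mathcal{D}$, and each $\overline{C}\,\overline{D}$ a finite $F$-linear combination of the $\overline{E}$, $E\in\mathcal{D}$; members of $\mathcal{D}$ are $\mathcal{S}$-classes, an $\mathcal{S}$-subgroup is a subgroup that is a union of classes. $\mathbb{Z}_p$ is always an $\mathcal{S}$-subgroup, and every Schur ring over $\mathbb{Z}_p$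 is of the form $F[\mathbb{Z}_p]^{\mathcal{H}}$ (elements fixed by $\mathcal{H}$, classes the $\mathcal{H}$-orbits) for a subgroup $\mathcal{H}\le\operatorname{Aut}(\mathbb{Z}_p)$. $\mathcal{S}$ is automorphic if $\mathcal{S}=F[G]^{\mathcal{H}'}$ for some finite $\mathcal{H}'\le\operatorname{Aut}(G)$. $\mathcal{S}$ is a wedge product if there are nontrivial proper $\mathcal{S}$-subgroups $K\le L$ with $K$ normal such that every $\mathcal{S}$-class outside $L$ is a union of cosets of $K$. *)

theory Defs
  imports "HOL-Algebra.Algebra"
begin

definition gsupp :: "('a \<Rightarrow> 'f::zero) \<Rightarrow> 'a set" where
  "gsupp x = {g. x g \<noteq> 0}"

definition grp_alg :: "('a, 'b) monoid_scheme \<Rightarrow> ('a \<Rightarrow> 'f::field) set" where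
  "grp_alg G = {x. finite (gsupp x) \<and> gsupp x \<subseteq> carrier G}"

text \<open>The element \<open>\<overline>C\<close> = sum of the elements of C.\<close>
definition bar :: "'a set \<Rightarrow> 'a \<Rightarrow> 'f::field" where
  "bar C = (\<lambda>g. if g \<in> C then 1 else 0)"

definition conv :: "('a, 'b) monoid_scheme \<Rightarrow> ('a \<Rightarrow> 'f::field) \<Rightarrow> ('a \<Rightarrow> 'f) \<Rightarrow> 'a \<Rightarrow> 'f" where
  "conv G x y = (\<lambda>g. if g \<in> carrier G
      then (\<Sum>h\<in>gsupp x. x h * y (inv\<^bsub>G\<^esub> h \<otimes>\<^bsub>G\<^esub> g)) else 0)"

definition span_classes :: "'a set set \<Rightarrow> ('a \<Rightarrow> 'f::field) set" where
  "span_classes D = {x. \<exists>E c. finite E \<and> E \<subseteq> D \<and> x = (\<lambda>g. \<Sum>e\<in>E. c e * bar e g)}"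

definition schur_ring :: "('a, 'b) monoid_scheme \<Rightarrow> ('a \<Rightarrow> 'f::field) set \<Rightarrow> 'a set set \<Rightarrow> bool" where
  "schur_ring G S D \<longleftrightarrow>
     (\<forall>C\<in>D. C \<noteq> {} \<and> finite C \<and> C \<subseteq> carrier G) \<and>
     (\<forall>C\<in>D. \<forall>C'\<in>D. C \<noteq> C' \<longrightarrow> C \<inter> C' = {}) \<and>
     \<Union>D = carrier G \<and>
     {\<one>\<^bsub>G\<^esub>} \<in> D \<and>
     (\<forall>C\<in>D. (\<lambda>g. inv\<^bsub>G\<^esub> g) ` C \<in> D) \<and>
     S = span_classes D \<and>
     (\<forall>C\<in>D. \<forall>C'\<in>D. conv G (bar C) (bar C') \<in> S)"

definition S_subgroup :: "('a, 'b) monoid_scheme \<Rightarrow> 'a set set \<Rightarrow> 'a set \<Rightarrow> bool" where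
  "S_subgroup G D K \<longleftrightarrow> subgroup K G \<and> (\<forall>C\<in>D. C \<subseteq> K \<or> C \<inter> K = {})"

definition fixed_alg :: "('a, 'b) monoid_scheme \<Rightarrow> ('a \<Rightarrow> 'a) set \<Rightarrow> ('a \<Rightarrow> 'f::field) set" where
  "fixed_alg G Hc = {x \<in> grp_alg G. \<forall>\<sigma>\<in>Hc. \<forall>g\<in>carrier G. x (\<sigma> g) = x g}"

definition automorphic :: "('a, 'b) monoid_scheme \<Rightarrow> ('a \<Rightarrow> 'f::field) set \<Rightarrow> bool" where
  "automorphic G S \<longleftrightarrow> (\<exists>Hc. subgroup Hc (AutoGroup G) \<and> finite Hc \<and> S = fixed_alg G Hc)"

definition wedge_product :: "('a, 'b) monoid_scheme \<Rightarrow> 'a set set \<Rightarrow> bool" where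
  "wedge_product G D \<longleftrightarrow> (\<exists>K L.
     S_subgroup G D K \<and> S_subgroup G D L \<and> K \<subseteq> L \<and> K \<lhd> G \<and>
     K \<noteq> {\<one>\<^bsub>G\<^esub>} \<and> K \<noteq> carrier G \<and> L \<noteq> {\<one>\<^bsub>G\<^esub>} \<and> L \<noteq> carrier G \<and>
     (\<forall>C\<in>D. \<not> C \<subseteq> L \<longrightarrow> (\<forall>c\<in>C. c <#\<^bsub>G\<^esub> K \<subseteq> C)))"

definition Zp :: "nat \<Rightarrow> int monoid" where
  "Zp p = integer_mod_group p"

definition ZxZp :: "nat \<Rightarrow> (int \<times> int) monoid" where
  "ZxZp p = DirProd integer_group (integer_mod_group p)"

definition embZp :: "(int \<Rightarrow> 'f::zero) \<Rightarrow> int \<times> int \<Rightarrow> 'f" where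
  "embZp y = (\<lambda>(i, j). if i = 0 then y j else 0)"

end

(* The group ring is modelled by integer-valued finitely supported functions on Z x Z, read
   modulo (0, p). Write T for the part of S over Z_p and m for the common size of the nontrivial
   classes in T.

   Frobenius congruences x ^ q = sum of q-th powers (mod q) show that raising to a power prime to p
   maps S-sets to S-sets, and that all classes in the quotient Z have the form {i} or {i, -i}.
   The layers i in which some class is not a union of Z_p-cosets form a subgroup N of Z; if N is not
   Z, then S is a wedge product with K = Z_p and L = N x Z_p. If N = Z, the p-th power of a class
   is, modulo p, supported on {z^(pi), z^(-pi)}, so H contains z^p and the given class C lies over
   some i prime to p. Counting the coefficients over Z_p of Y C^*, for the i-th power Y of a class
   over 1 that does not meet C, shows that all classes over 1 but one have slices divisible by m.
   Proper slices are invertible modulo p, so there are at least 1 + (p - 1)/m classes over 1, and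
   the exceptional slice is a single element z'. Hence {z'} or {z', z'^(-1) a^c} is a class, and
   this together with T determines all classes as orbits of a finite group of automorphisms. *)
theory Submission
  imports Defs "HOL-Library.Poly_Mapping" "HOL-Library.Product_Plus"
begin

text \<open>The field enters only through the structure constants. These count pairs of group
  elements, and in characteristic 0 two counts that agree in F agree as integers. So the same
  classes carry an integral Schur ring, in which congruences modulo a prime make sense.

  The projection sees the sizes of slices but not their positions, and a slice with one element is
  what removes this ambiguity. Coprimality of m and the size of C is used twice: to cancel the size
  of C in a divisibility by m, and, when the layers i and -i are linked, to make m odd, because C
  then has an even number of elements. Without oddness a class could contain one half of an orbit
  over i and the other half over -i.\<close>

type_synonym zz = "int \<times> int"
type_synonym zring = "(int \<times> int) \<Rightarrow>\<^sub>0 int"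

section \<open>Frobenius congruences in the integral group ring of Z x Z\<close>

lemma sum_power_prime_expand:
  fixes f :: "'b \<Rightarrow> 'a::comm_ring_1"
  assumes "Factorial_Ring.prime q" "finite A"
  shows "\<exists>r. (\<Sum>u\<in>A. f u) ^ q = (\<Sum>u\<in>A. f u ^ q) + of_nat q * r"
proof -
  have q0: "q > 0" using assms(1) by (simp add: prime_gt_0_nat)
  have two: "\<exists>r. (x + y) ^ q = x ^ q + y ^ q + of_nat q * r" for x y :: 'a
  proof -
    have "(x + y) ^ q = (\<Sum>k\<le>q. of_nat (q choose k) * x ^ k * y ^ (q - k))"
      by (rule binomial_ring)
    also have "{..q} = insert 0 (insert q {0<..<q})" using q0 by auto
    also have "(\<Sum>k\<in>insert 0 (insert q {0<..<q}). of_nat (q choose k) * x ^ k * y ^ (q - k))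
        = y ^ q + (x ^ q + (\<Sum>k\<in>{0<..<q}. of_nat (q choose k) * x ^ k * y ^ (q - k)))"
      using q0 by (simp add: sum.insert)
    also have "(\<Sum>k\<in>{0<..<q}. of_nat (q choose k) * x ^ k * y ^ (q - k))
        = (\<Sum>k\<in>{0<..<q}. of_nat q * (of_nat ((q choose k) div q) * x ^ k * y ^ (q - k)))"
    proof (rule sum.cong)
      fix k assume "k \<in> {0<..<q}"
      then have "q dvd (q choose k)" using assms(1) by (intro dvd_choose_prime) auto
      then have "q choose k = q * ((q choose k) div q)" by simp
      then have "(of_nat (q choose k) :: 'a) = of_nat q * of_nat ((q choose k) div q)"
        by (metis of_nat_mult)
      then show "of_nat (q choose k) * x ^ k * y ^ (q - k)
        = of_nat q * (of_nat ((q choose k) div q) * x ^ k * y ^ (q - k))"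
        by (simp add: mult.assoc)
    qed simp
    also have "\<dots> = of_nat q * (\<Sum>k\<in>{0<..<q}. of_nat ((q choose k) div q) * x ^ k * y ^ (q - k))"
      by (simp add: sum_distrib_left)
    finally show ?thesis by (metis (no_types, lifting) add.assoc add.commute)
  qed
  show ?thesis using assms(2)
  proof (induction A rule: finite_induct)
    case empty
    show ?case using q0 by (intro exI[of _ 0]) (simp add: zero_power)
  next
    case (insert a A)
    obtain r1 where r1: "(\<Sum>u\<in>A. f u) ^ q = (\<Sum>u\<in>A. f u ^ q) + of_nat q * r1"
      using insert.IH by blast
    obtain r2 where r2: "(f a + (\<Sum>u\<in>A. f u)) ^ q = f a ^ q + (\<Sum>u\<in>A. f u) ^ q + of_nat q * r2"
      using two by blast
    have "(\<Sum>u\<in>insert a A. f u) ^ q = (\<Sum>u\<in>insert a A. f u ^ q) + of_nat q * (r1 + r2)"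
      using insert.hyps by (simp add: r2 r1 algebra_simps)
    then show ?case by blast
  qed
qed

text \<open>The n-th power of a group element in additive notation; negative n occur as
  well.\<close>

definition scale :: "int \<Rightarrow> zz \<Rightarrow> zz" where
  "scale n u = (n * fst u, n * snd u)"

lemma fst_scale [simp]: "fst (scale n u) = n * fst u"
  and snd_scale [simp]: "snd (scale n u) = n * snd u"
  by (simp_all add: scale_def)

lemma scale_scale: "scale m (scale n u) = scale (m * n) u"
  by (simp add: scale_def)

lemma single_power: "(Poly_Mapping.single (u::zz) (1::int)) ^ n = Poly_Mapping.single (scale (int n) u) 1"
proof (induction n)
  case 0
  have "scale 0 u = 0" by (simp add: scale_def zero_prod_def)
  then show ?case by simp
next
  case (Suc n)
  have "u + scale (int n) u = scale (int (Suc n)) u"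
    by (simp add: scale_def prod_eq_iff algebra_simps)
  then show ?case using Suc by (simp add: mult_single)
qed

text \<open>Integral counterpart of \<open>bar\<close>, as an element of a commutative ring that has
  powers.\<close>

definition bsum :: "zz set \<Rightarrow> zring" where
  "bsum B = (\<Sum>u\<in>B. Poly_Mapping.single u 1)"

text \<open>The remainder \<open>r\<close> is kept explicit, so that the congruence can be
  multiplied by further elements and read off coefficientwise without forming a ring modulo
  q.\<close>

lemma bsum_power_prime:
  assumes "Factorial_Ring.prime q" "finite B"
  shows "\<exists>r. bsum B ^ q = (\<Sum>u\<in>B. Poly_Mapping.single (scale (int q) u) 1) + of_nat q * r"
  using sum_power_prime_expand[OF assms, of "\<lambda>u. Poly_Mapping.single u (1::int)"]
  by (simp add: bsum_def single_power)

lemma pm_expand: "(x::zring) = (\<Sum>u\<in>Poly_Mapping.keys x. Poly_Mapping.single u (Poly_Mapping.lookup x u))"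
proof (rule poly_mapping_eqI)
  fix k
  show "Poly_Mapping.lookup x k = Poly_Mapping.lookup (\<Sum>u\<in>Poly_Mapping.keys x. Poly_Mapping.single u (Poly_Mapping.lookup x u)) k"
    by (auto simp: lookup_sum lookup_single when_def not_in_keys_iff_lookup_eq_zero)
qed

section \<open>Coefficients modulo (0, p)\<close>

locale modp =
  fixes p :: nat
  assumes prime_p: "Factorial_Ring.prime p"
begin

lemma p_gt1: "int p > 1" using prime_p prime_gt_1_nat by auto
lemma p_pos [simp]: "int p > 0" using p_gt1 by simp
lemma p_nz [simp]: "p > 0" using p_gt1 by simp

definition red :: "zz \<Rightarrow> zz" where "red u = (fst u, snd u mod int p)"

lemma fst_red [simp]: "fst (red u) = fst u" by (simp add: red_def)
lemma snd_red [simp]: "snd (red u) = snd u mod int p" by (simp add: red_def)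
lemma red_red [simp]: "red (red u) = red u" by (simp add: red_def)

lemma red_eq_iff: "red u = red v \<longleftrightarrow> fst u = fst v \<and> int p dvd snd u - snd v"
  by (auto simp: red_def mod_eq_dvd_iff)

definition reps :: "zz set" where "reps = UNIV \<times> {0..<int p}"

lemma red_in_reps [simp]: "red u \<in> reps" by (auto simp: reps_def red_def)
lemma red_id: "u \<in> reps \<Longrightarrow> red u = u" by (auto simp: reps_def red_def)

lemma red_add_cong: "red u = red u' \<Longrightarrow> red v = red v' \<Longrightarrow> red (u + v) = red (u' + v')"
  by (auto simp: red_def intro: mod_add_cong)
lemma red_diff_cong: "red u = red u' \<Longrightarrow> red v = red v' \<Longrightarrow> red (u - v) = red (u' - v')"
  by (auto simp: red_def intro: mod_diff_cong)
lemma red_uminus_cong: "red u = red u' \<Longrightarrow> red (- u) = red (- u')"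
  by (auto simp: red_def intro: mod_minus_cong)
lemma red_scale_cong: "red u = red u' \<Longrightarrow> red (scale n u) = red (scale n u')"
  by (auto simp: red_def intro: mod_mult_cong)

text \<open>On Z the factor n cancels because it is nonzero, on Z_p because it is a unit
  there.\<close>

lemma red_scale_inj:
  assumes "red (scale n u) = red (scale n v)" "n \<noteq> 0" "\<not> int p dvd n"
  shows "red u = red v"
proof -
  have "int p dvd n * (snd u - snd v)" using assms(1) by (simp add: red_eq_iff algebra_simps)
  moreover have "Factorial_Ring.prime (int p)" using prime_p by simp
  ultimately have "int p dvd snd u - snd v" using assms(3) by (simp add: prime_dvd_mult_iff)
  then show ?thesis using assms by (simp add: red_eq_iff)
qed

text \<open>Summing over a fibre of \<open>red\<close> is the projection to the group ring of Z x
  Z_p. Computing upstairs gives the ring structure for free; the price is that equality downstairs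
  means equality of all values \<open>coef x g\<close>.\<close>

definition coef :: "zring \<Rightarrow> zz \<Rightarrow> int" where
  "coef x g = (\<Sum>u\<in>Poly_Mapping.keys x. if red u = red g then Poly_Mapping.lookup x u else 0)"

lemma coef_superset:
  assumes "finite B" "Poly_Mapping.keys x \<subseteq> B"
  shows "coef x g = (\<Sum>u\<in>B. if red u = red g then Poly_Mapping.lookup x u else 0)"
  unfolding coef_def using assms
  by (intro sum.mono_neutral_left) (auto simp: in_keys_iff)

lemma coef_red [simp]: "coef x (red g) = coef x g"
  by (simp add: coef_def)

lemma coef_cong: "red g = red h \<Longrightarrow> coef x g = coef x h"
  by (simp add: coef_def)

lemma coef_0 [simp]: "coef 0 g = 0" by (simp add: coef_def)

lemma coef_add: "coef (x + y) g = coef x g + coef y g"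
proof -
  let ?B = "Poly_Mapping.keys x \<union> Poly_Mapping.keys y"
  have "Poly_Mapping.keys (x + y) \<subseteq> ?B" by (rule keys_add)
  then have "coef (x + y) g = (\<Sum>u\<in>?B. if red u = red g then Poly_Mapping.lookup (x + y) u else 0)"
    by (intro coef_superset) auto
  also have "\<dots> = (\<Sum>u\<in>?B. (if red u = red g then Poly_Mapping.lookup x u else 0) + (if red u = red g then Poly_Mapping.lookup y u else 0))"
    by (intro sum.cong) (auto simp: lookup_add)
  also have "\<dots> = coef x g + coef y g"
    by (simp add: sum.distrib coef_superset[of ?B])
  finally show ?thesis .
qed

lemma coef_sum: "coef (\<Sum>i\<in>I. f i) g = (\<Sum>i\<in>I. coef (f i) g)"
  by (induction I rule: infinite_finite_induct) (auto simp: coef_add)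

lemma coef_single: "coef (Poly_Mapping.single u c) g = (if red u = red g then c else 0)"
  by (cases "c = 0") (auto simp: coef_def)

lemma coef_diff: "coef (x - y) g = coef x g - coef y g"
  using coef_add[of "x - y" y g] by simp

lemma coef_single_mult: "coef (Poly_Mapping.single u c * x) g = c * coef x (g - u)"
proof -
  have "Poly_Mapping.single u c * x = (\<Sum>v\<in>Poly_Mapping.keys x. Poly_Mapping.single (u + v) (c * Poly_Mapping.lookup x v))"
    by (subst pm_expand[of x]) (simp add: sum_distrib_left mult_single)
  then have "coef (Poly_Mapping.single u c * x) g = (\<Sum>v\<in>Poly_Mapping.keys x. if red (u + v) = red g then c * Poly_Mapping.lookup x v else 0)"
    by (simp add: coef_sum coef_single)
  also have "\<dots> = c * coef x (g - u)"
    unfolding coef_def sum_distrib_left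
  proof (rule sum.cong)
    fix v
    have "red (u + v) = red g \<longleftrightarrow> red v = red (g - u)"
      using red_diff_cong[of "u + v" g u u] red_add_cong[of v "g - u" u u]
      by (auto simp: algebra_simps)
    then show "(if red (u + v) = red g then c * Poly_Mapping.lookup x v else 0)
        = c * (if red v = red (g - u) then Poly_Mapping.lookup x v else 0)" by simp
  qed simp
  finally show ?thesis .
qed

lemma coef_mult: "coef (x * y) g = (\<Sum>u\<in>Poly_Mapping.keys x. Poly_Mapping.lookup x u * coef y (g - u))"
proof -
  have "x * y = (\<Sum>u\<in>Poly_Mapping.keys x. Poly_Mapping.single u (Poly_Mapping.lookup x u) * y)"
    by (subst pm_expand[of x]) (simp add: sum_distrib_right)
  then show ?thesis by (simp add: coef_sum coef_single_mult)
qed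

text \<open>The product descends to the group ring of Z x Z_p: \<open>coef_mult\<close> sees the
  right factor only through \<open>coef\<close>, and commutativity gives the same for the left
  factor.\<close>

lemma coef_mult_cong:
  assumes "\<And>g. coef x g = coef x' g" "\<And>g. coef y g = coef y' g"
  shows "coef (x * y) g = coef (x' * y') g"
proof -
  have "coef (x * y) g = coef (x * y') g" by (simp add: coef_mult assms)
  also have "\<dots> = coef (x' * y') g" by (subst (1 2) mult.commute) (simp add: coef_mult assms)
  finally show ?thesis .
qed

lemma coef_of_nat_mult: "coef (of_nat n * x) g = int n * coef x g"
proof -
  have "(of_nat n :: zring) = Poly_Mapping.single 0 (int n)" by simp
  then show ?thesis by (metis coef_single_mult diff_zero)
qed

lemma coef_mult_dvd:
  assumes "\<And>g. d dvd coef y g"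
  shows "d dvd coef (x * y) g"
  unfolding coef_mult by (intro dvd_sum dvd_mult assms)

lemma coef_bsum: "finite B \<Longrightarrow> coef (bsum B) g = int (card {u\<in>B. red u = red g})"
  by (simp add: bsum_def coef_sum coef_single sum.If_cases Int_def)

lemma coef_bsum_reps: "finite B \<Longrightarrow> B \<subseteq> reps \<Longrightarrow> coef (bsum B) g = (if red g \<in> B then 1 else 0)"
proof -
  assume *: "finite B" "B \<subseteq> reps"
  then have "{u\<in>B. red u = red g} = (if red g \<in> B then {red g} else {})"
    using red_id by auto
  with * show ?thesis by (simp add: coef_bsum)
qed

text \<open>A cardinality appears because several elements may have the same q-th power modulo (0,
  p), as happens for q = p.\<close>

lemma coef_bsum_power_prime:
  assumes "Factorial_Ring.prime q" "finite B"
  shows "int q dvd coef (bsum B ^ q) g - int (card {u\<in>B. red (scale (int q) u) = red g})"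
proof -
  obtain r where r: "bsum B ^ q = (\<Sum>u\<in>B. Poly_Mapping.single (scale (int q) u) 1) + of_nat q * r"
    using bsum_power_prime[OF assms] by blast
  show ?thesis using assms(2) unfolding r
    by (simp add: coef_add coef_of_nat_mult coef_sum coef_single sum.If_cases Int_def)
qed

lemma coef_bsum_mult:
  assumes "finite A" "finite B"
  shows "coef (bsum A * bsum B) g = int (card {w\<in>A \<times> B. red (fst w + snd w) = red g})"
proof -
  have "bsum A * bsum B = (\<Sum>w\<in>A \<times> B. Poly_Mapping.single (fst w + snd w) 1)"
    by (simp add: bsum_def sum_product mult_single sum.cartesian_product split_def)
  then show ?thesis using assms
    by (simp add: coef_sum coef_single sum.If_cases Int_def)
qed

section \<open>The group Z x Z_p on canonical representatives\<close>

lemma carrier_ZxZp [simp]: "carrier (ZxZp p) = reps"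
  using p_nz by (auto simp: ZxZp_def reps_def carrier_integer_mod_group)

lemma one_ZxZp [simp]: "\<one>\<^bsub>ZxZp p\<^esub> = 0"
  by (simp add: ZxZp_def zero_prod_def)

lemma mult_ZxZp [simp]: "u \<otimes>\<^bsub>ZxZp p\<^esub> v = red (u + v)"
  by (simp add: ZxZp_def mult_DirProd' red_def)

lemma comm_group_ZxZp: "comm_group (ZxZp p)"
proof -
  have "group (ZxZp p)" unfolding ZxZp_def by (intro DirProd_group) simp_all
  then show ?thesis by (rule group.group_comm_groupI) (simp add: add.commute)
qed

lemma group_ZxZp: "group (ZxZp p)"
  using comm_group_ZxZp comm_group.axioms(2) by blast

lemma inv_ZxZp [simp]: "u \<in> reps \<Longrightarrow> inv\<^bsub>ZxZp p\<^esub> u = red (- u)"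
proof -
  assume u: "u \<in> reps"
  have "red (red (- u) + u) = red (- u + u)" by (intro red_add_cong) simp_all
  then have "red (- u) \<otimes>\<^bsub>ZxZp p\<^esub> u = \<one>\<^bsub>ZxZp p\<^esub>" by (simp add: red_def zero_prod_def)
  then show ?thesis using u by (intro group.inv_equality[OF group_ZxZp]) simp_all
qed

lemma subgroup_ZxZpI:
  assumes "K \<subseteq> reps" "0 \<in> K" "\<And>u v. u \<in> K \<Longrightarrow> v \<in> K \<Longrightarrow> red (u + v) \<in> K" "\<And>u. u \<in> K \<Longrightarrow> red (- u) \<in> K"
  shows "subgroup K (ZxZp p)"
proof (rule group.subgroupI[OF group_ZxZp])
  fix a assume a: "a \<in> K"
  then have "a \<in> reps" using assms(1) by blast
  then show "inv\<^bsub>ZxZp p\<^esub> a \<in> K" using assms(4)[OF a] by simp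
qed (use assms in auto)

lemma coef_bsum_mult_left: "coef (bsum A * y) g = (\<Sum>u\<in>A. coef y (g - u))"
  by (simp add: bsum_def sum_distrib_right coef_sum coef_single_mult)

end

section \<open>Classes and the integral Schur ring\<close>

text \<open>Field-free form of a Schur ring: \<open>D_prod\<close> says that the structure
  constants, as counts of pairs, are constant on classes. \<open>W\<close> stands for the
  multipliers by which the automorphisms in the group of T act on Z_p.\<close>

locale zp_schur = modp +
  fixes D :: "zz set set" and W :: "int set"
  assumes D_finite: "C \<in> D \<Longrightarrow> finite C"
    and D_ne: "C \<in> D \<Longrightarrow> C \<noteq> {}"
    and D_disj: "C \<in> D \<Longrightarrow> C' \<in> D \<Longrightarrow> u \<in> C \<Longrightarrow> u \<in> C' \<Longrightarrow> C = C'"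
    and D_cover: "\<Union>D = reps"
    and D_one: "{0} \<in> D"
    and D_inv: "C \<in> D \<Longrightarrow> (\<lambda>u. red (- u)) ` C \<in> D"
    and D_prod: "C \<in> D \<Longrightarrow> C' \<in> D \<Longrightarrow> E \<in> D \<Longrightarrow> g \<in> E \<Longrightarrow> h \<in> E \<Longrightarrow>
      card {w\<in>C \<times> C'. red (fst w + snd w) = g} = card {w\<in>C \<times> C'. red (fst w + snd w) = h}"
    and W_sub: "W \<subseteq> {1..<int p}"
    and W_orb: "(\<lambda>w. red (0, w * j)) ` W \<in> D"
    and W_one: "1 \<in> W"
begin

lemma W_finite: "finite W" using W_sub finite_subset by blast

text \<open>Defined on all of Z x Z through \<open>red\<close>, so that related elements can be
  added and scaled without normalising them.\<close>

definition rel :: "zz \<Rightarrow> zz \<Rightarrow> bool" where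
  "rel g h \<longleftrightarrow> (\<exists>E\<in>D. red g \<in> E \<and> red h \<in> E)"

definition cl :: "zz \<Rightarrow> zz set" where
  "cl g = {h\<in>reps. rel g h}"

lemma D_reps: "C \<in> D \<Longrightarrow> C \<subseteq> reps" using D_cover by auto

lemma D_red: "C \<in> D \<Longrightarrow> u \<in> C \<Longrightarrow> red u = u" using D_reps red_id by blast

lemma rel_refl [simp]: "rel g g"
  unfolding rel_def using D_cover red_in_reps by (metis UnionE)
lemma rel_sym: "rel g h \<Longrightarrow> rel h g" unfolding rel_def by auto
lemma rel_trans: "rel g h \<Longrightarrow> rel h k \<Longrightarrow> rel g k"
  unfolding rel_def by (metis D_disj)
lemma rel_red1 [simp]: "rel (red g) h = rel g h" by (simp add: rel_def)
lemma rel_red2 [simp]: "rel g (red h) = rel g h" by (simp add: rel_def)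
lemma rel_cong: "red g = red g' \<Longrightarrow> red h = red h' \<Longrightarrow> rel g h = rel g' h'" by (simp add: rel_def)

lemma cl_eq:
  assumes "E \<in> D" "red g \<in> E"
  shows "cl g = E"
proof (intro equalityI subsetI)
  fix h assume "h \<in> cl g"
  then obtain E' where h: "red h = h" "E' \<in> D" "red g \<in> E'" "red h \<in> E'"
    by (metis (mono_tags, lifting) cl_def mem_Collect_eq red_id rel_def)
  then show "h \<in> E" using D_disj[OF assms(1) h(2) assms(2) h(3)] by simp
next
  fix h assume h: "h \<in> E"
  then have "red h = h" "h \<in> reps" using D_red D_reps assms(1) by blast+
  then show "h \<in> cl g" using assms h unfolding cl_def rel_def by (metis (mono_tags, lifting) mem_Collect_eq)
qed

lemma cl_D: "cl g \<in> D"
proof -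
  obtain E where "E \<in> D" "red g \<in> E" using rel_refl[of g] unfolding rel_def by blast
  then show ?thesis using cl_eq by simp
qed

lemma cl_finite [simp]: "finite (cl g)" using cl_D D_finite by blast
lemma cl_reps: "cl g \<subseteq> reps" by (auto simp: cl_def)
lemma red_in_cl [simp]: "red h \<in> cl g \<longleftrightarrow> rel g h" by (simp add: cl_def)
lemma cl_rel: "u \<in> cl g \<Longrightarrow> rel g u" by (simp add: cl_def)
lemma cl_red: "u \<in> cl g \<Longrightarrow> red u = u" using cl_reps red_id by blast
lemma cl_iff: "u \<in> cl g \<longleftrightarrow> rel g u \<and> red u = u" using cl_red[of u g] red_in_cl[of u g] by metis
lemma D_cl: "C \<in> D \<Longrightarrow> u \<in> C \<Longrightarrow> C = cl u" using cl_eq D_red by metis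
lemma cl_cong: "rel g h \<Longrightarrow> cl g = cl h"
  unfolding cl_def using rel_trans rel_sym by blast

lemma rel_uminus: "rel g h \<Longrightarrow> rel (- g) (- h)"
proof -
  assume "rel g h"
  then obtain E where E: "E \<in> D" "red g \<in> E" "red h \<in> E" by (auto simp: rel_def)
  have "red (- red g) = red (- g)" "red (- red h) = red (- h)"
    by (rule red_uminus_cong; simp)+
  then have "red (- g) \<in> (\<lambda>u. red (- u)) ` E" "red (- h) \<in> (\<lambda>u. red (- u)) ` E"
    using imageI[OF E(2), of "\<lambda>u. red (- u)"] imageI[OF E(3), of "\<lambda>u. red (- u)"] by simp_all
  then show ?thesis unfolding rel_def using bexI[OF _ D_inv[OF E(1)]] by simp
qed

text \<open>The integral form of S. Constancy on classes is preferred to being a combination of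
  class sums, since the arguments below compare coefficients at two elements of one class.\<close>

definition int_schur :: "zring set" where
  "int_schur = {x. \<forall>g h. rel g h \<longrightarrow> coef x g = coef x h}"

lemma int_schur_D: "x \<in> int_schur \<Longrightarrow> rel g h \<Longrightarrow> coef x g = coef x h" unfolding int_schur_def by blast
lemma int_schur_I: "(\<And>g h. rel g h \<Longrightarrow> coef x g = coef x h) \<Longrightarrow> x \<in> int_schur" unfolding int_schur_def by blast

lemma int_schur_add: "x \<in> int_schur \<Longrightarrow> y \<in> int_schur \<Longrightarrow> x + y \<in> int_schur" by (simp add: int_schur_def coef_add)
lemma int_schur_diff: "x \<in> int_schur \<Longrightarrow> y \<in> int_schur \<Longrightarrow> x - y \<in> int_schur" by (simp add: int_schur_def coef_diff)
lemma int_schur_cong: "x \<in> int_schur \<Longrightarrow> (\<And>g. coef x g = coef y g) \<Longrightarrow> y \<in> int_schur" by (simp add: int_schur_def)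

lemma int_schur_bsum:
  assumes "finite B" "B \<subseteq> reps" "\<And>g h. rel g h \<Longrightarrow> red g \<in> B \<Longrightarrow> red h \<in> B"
  shows "bsum B \<in> int_schur"
  using assms by (intro int_schur_I) (auto simp: coef_bsum_reps dest: rel_sym)

lemma int_schur_bsum_cl: "bsum (cl g) \<in> int_schur"
  by (rule int_schur_bsum) (use cl_reps in \<open>simp_all, blast intro: rel_trans\<close>)

lemma int_schur_bsum_cl_mult: "bsum (cl a) * bsum (cl b) \<in> int_schur"
proof (rule int_schur_I)
  fix g h assume "rel g h"
  then obtain E where "E \<in> D" "red g \<in> E" "red h \<in> E" by (auto simp: rel_def)
  from D_prod[OF cl_D cl_D this, of a b]
  show "coef (bsum (cl a) * bsum (cl b)) g = coef (bsum (cl a) * bsum (cl b)) h"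
    by (simp add: coef_bsum_mult)
qed

text \<open>Recovers the combination of class sums, through which \<open>D_prod\<close> extends
  bilinearly to all products.\<close>

lemma int_schur_expand:
  assumes "x \<in> int_schur"
  obtains F c where "finite F" "\<And>g. coef x g = coef (\<Sum>u\<in>F. Poly_Mapping.single 0 (c u) * bsum (cl u)) g"
proof -
  let ?K = "(\<lambda>u. cl u) ` Poly_Mapping.keys x"
  \<comment> \<open>One fixed representative for each class, so that no class sum is added
    twice.\<close>
  define r where "r E = (SOME u. cl u = E)" for E
  have r: "cl (r (cl u)) = cl u" for u unfolding r_def by (rule someI[of _ u]) simp
  define F where "F = r ` ?K"
  have "finite F" by (simp add: F_def)
  moreover have "coef x g = coef (\<Sum>u\<in>F. Poly_Mapping.single 0 (coef x u) * bsum (cl u)) g" for g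
  proof -
    have eq: "coef (\<Sum>u\<in>F. Poly_Mapping.single 0 (coef x u) * bsum (cl u)) g
        = (\<Sum>u\<in>F. if rel u g then coef x g else 0)"
      unfolding coef_sum
    proof (rule sum.cong)
      fix u
      show "coef (Poly_Mapping.single 0 (coef x u) * bsum (cl u)) g = (if rel u g then coef x g else 0)"
        using int_schur_D[OF assms, of u g] by (simp add: coef_single_mult coef_bsum_reps cl_reps)
    qed simp
    show ?thesis
    proof (cases "\<exists>u\<in>F. rel u g")
      case True
      then obtain u where u: "u \<in> F" "rel u g" by blast
      have vu: "v = u" if "v \<in> F" "rel v g" for v
      proof -
        have "cl v = cl u" using that u rel_trans rel_sym cl_cong by metis
        moreover have "r (cl v) = v" if "v \<in> F" for v
          using that r unfolding F_def by auto
        ultimately show ?thesis using that(1) u(1) by metis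
      qed
      then have "(\<Sum>u\<in>F. if rel u g then coef x g else 0) = (\<Sum>v\<in>F. if v = u then coef x g else 0)"
        using u(2) by (intro sum.cong refl if_cong) blast+
      then show ?thesis using eq u \<open>finite F\<close> by simp
    next
      case False
      have "coef x g = 0" unfolding coef_def
      proof (rule sum.neutral, intro ballI)
        fix v assume v: "v \<in> Poly_Mapping.keys x"
        show "(if red v = red g then Poly_Mapping.lookup x v else 0) = 0"
        proof (cases "red v = red g")
          case True
          have "r (cl v) \<in> F" using v by (auto simp: F_def)
          moreover have "rel (r (cl v)) g"
          proof -
            have "rel v g" using True rel_cong[of v g g g] by simp
            then show ?thesis using r[of v] red_in_cl[of g v] red_in_cl[of g "r (cl v)"] by simp
          qed
          ultimately show ?thesis using False by blast
        qed simp
      qed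
      then show ?thesis using eq False by (auto intro!: sum.neutral)
    qed
  qed
  ultimately show ?thesis using that[of F "coef x"] by blast
qed

lemma int_schur_mult: assumes "x \<in> int_schur" "y \<in> int_schur" shows "x * y \<in> int_schur"
proof -
  obtain F c where F: "finite F" "\<And>g. coef x g = coef (\<Sum>u\<in>F. Poly_Mapping.single 0 (c u) * bsum (cl u)) g"
    using int_schur_expand[OF assms(1)] by metis
  obtain F' c' where F': "finite F'" "\<And>g. coef y g = coef (\<Sum>u\<in>F'. Poly_Mapping.single 0 (c' u) * bsum (cl u)) g"
    using int_schur_expand[OF assms(2)] by metis
  have eq: "coef (x * y) g = (\<Sum>u\<in>F. \<Sum>v\<in>F'. c u * c' v * coef (bsum (cl u) * bsum (cl v)) g)" for g
  proof -
    have "coef (x * y) g = coef ((\<Sum>u\<in>F. Poly_Mapping.single 0 (c u) * bsum (cl u)) * (\<Sum>u\<in>F'. Poly_Mapping.single 0 (c' u) * bsum (cl u))) g"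
      by (rule coef_mult_cong[OF F(2) F'(2)])
    also have "\<dots> = coef (\<Sum>u\<in>F. \<Sum>v\<in>F'. Poly_Mapping.single 0 (c u * c' v) * (bsum (cl u) * bsum (cl v))) g"
    proof -
      have "Poly_Mapping.single 0 a * y * (Poly_Mapping.single 0 b * z) = Poly_Mapping.single 0 (a * b) * (y * z)"
        for a b :: int and y z :: zring
        using mult_single[of "0::zz" a 0 b] by (simp add: mult_ac flip: mult.assoc)
      then show ?thesis by (simp only: sum_product)
    qed
    finally show ?thesis by (simp add: coef_sum coef_single_mult)
  qed
  show ?thesis
    by (rule int_schur_I) (simp add: eq int_schur_D[OF int_schur_bsum_cl_mult])
qed

lemma int_schur_1: "1 \<in> int_schur"
proof -
  have "red (0::zz) = 0" by (simp add: red_def zero_prod_def)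
  then have "cl 0 = {0}" using cl_eq[OF D_one, of 0] by simp
  then show ?thesis using int_schur_bsum_cl[of 0] by (simp add: bsum_def)
qed

lemma int_schur_power: "x \<in> int_schur \<Longrightarrow> x ^ n \<in> int_schur"
  by (induction n) (auto simp: int_schur_1 int_schur_mult)

lemma red_0 [simp]: "red 0 = 0" by (simp add: red_def zero_prod_def)

lemma cl_0: "cl 0 = {0}" using cl_eq[OF D_one, of 0] by simp

section \<open>Powers prime to p\<close>

text \<open>Multiplication by q is injective, so the q-th power of the class sum has coefficient 1
  modulo q at \<open>scale (int q) u\<close>. The coefficient at \<open>h\<close> is the same, hence
  nonzero modulo q, and \<open>h\<close> must be the q-th power of some element of the
  class.\<close>

lemma mult_prime:
  assumes "Factorial_Ring.prime q" "q \<noteq> p" "rel (scale (int q) u) h"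
  shows "\<exists>v. rel u v \<and> red (scale (int q) v) = red h"
proof -
  let ?B = "cl u"
  define N where "N g = {v\<in>?B. red (scale (int q) v) = red g}" for g
  have q: "int q dvd coef (bsum ?B ^ q) g - int (card (N g))" for g
    unfolding N_def by (rule coef_bsum_power_prime[OF assms(1)]) simp
  have npq: "\<not> int p dvd int q" "int q \<noteq> 0"
    using assms(1,2) prime_p by (auto dest: primes_dvd_imp_eq prime_gt_0_nat)
  have "N (scale (int q) u) = {red u}"
  proof (intro equalityI subsetI)
    fix v assume v: "v \<in> N (scale (int q) u)"
    then have "red v = red u" using red_scale_inj[OF _ npq(2,1)] unfolding N_def by blast
    moreover have "red v = v" using v cl_red unfolding N_def by blast
    ultimately show "v \<in> {red u}" by simp
  next
    fix v assume "v \<in> {red u}"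
    then show "v \<in> N (scale (int q) u)"
      using red_scale_cong[of "red u" u "int q"] by (simp add: N_def)
  qed
  then have 1: "int q dvd coef (bsum ?B ^ q) h - 1"
    using q[of "scale (int q) u"] int_schur_D[OF int_schur_power[OF int_schur_bsum_cl] assms(3)] by simp
  have "card (N h) \<noteq> 0"
  proof
    assume "card (N h) = 0"
    then have "int q dvd coef (bsum ?B ^ q) h" using q[of h] by simp
    with 1 have "int q dvd 1" by (metis dvd_diffD1 dvd_diff diff_diff_eq2 add_diff_cancel_left')
    then show False using assms(1) prime_gt_1_nat by fastforce
  qed
  then have "N h \<noteq> {}" by auto
  then show ?thesis by (auto simp: N_def dest: cl_rel)
qed

text \<open>Prime factors of n are split off one at a time; none of them is p.\<close>

lemma mult_nat:
  assumes "n > 0" "\<not> p dvd n" "rel (scale (int n) u) h"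
  shows "\<exists>v. rel u v \<and> red (scale (int n) v) = red h"
  using assms
proof (induction n arbitrary: u h rule: less_induct)
  case (less n)
  show ?case
  proof (cases "n = 1")
    case True
    then show ?thesis using less.prems by (intro exI[of _ h]) (simp add: scale_def)
  next
    case False
    then obtain q where q: "Factorial_Ring.prime q" "q dvd n" using prime_factor_nat by blast
    then obtain k where k: "n = q * k" by (auto elim: dvdE)
    have k': "k > 0" "k < n" "\<not> p dvd k" using less.prems(1,2) k prime_gt_1_nat[OF q(1)] by auto
    have "q \<noteq> p" using q less.prems by auto
    have "rel (scale (int q) (scale (int k) u)) h" using less.prems(3) by (simp add: scale_scale k)
    from mult_prime[OF q(1) \<open>q \<noteq> p\<close> this]
    obtain v where v: "rel (scale (int k) u) v" "red (scale (int q) v) = red h" by blast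
    from less.IH[OF k'(2,1,3) v(1)] obtain v' where v': "rel u v'" "red (scale (int k) v') = red v"
      by blast
    have "red (scale (int n) v') = red (scale (int q) (scale (int k) v'))" by (simp add: scale_scale k)
    also have "\<dots> = red h" using red_scale_cong[OF v'(2)] v(2) by metis
    finally show ?thesis using v'(1) by blast
  qed
qed

lemma mult_int:
  assumes "n \<noteq> 0" "\<not> int p dvd n" "rel (scale n u) h"
  shows "\<exists>v. rel u v \<and> red (scale n v) = red h"
proof (cases "n > 0")
  case True
  then show ?thesis using mult_nat[of "nat n" u h] assms by (auto simp: nat_dvd_iff int_dvd_int_iff[symmetric])
next
  case False
  have m: "- scale n u = scale (- n) u" for u by (simp add: scale_def)
  have "rel (scale (- n) u) (- h)" using rel_uminus[OF assms(3)] by (simp add: m)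
  then have "\<exists>v. rel u v \<and> red (scale (- n) v) = red (- h)"
    using mult_nat[of "nat (- n)" u "- h"] False assms by (auto simp: int_dvd_int_iff[symmetric])
  then obtain v where "rel u v" "red (scale (- n) v) = red (- h)" by blast
  then have "red (scale n v) = red h" using red_uminus_cong[of "scale (- n) v" "- h"] by (simp add: scale_def)
  with \<open>rel u v\<close> show ?thesis by blast
qed

section \<open>The quotient by Z_p and the linked layers\<close>

definition zp_sum :: zring where "zp_sum = bsum ({0} \<times> {0..<int p})"

lemma coef_zp_sum: "coef zp_sum g = (if fst g = 0 then 1 else 0)"
proof -
  have "red g \<in> {0} \<times> {0..<int p} \<longleftrightarrow> fst g = 0" by (auto simp: red_def)
  then show ?thesis unfolding zp_sum_def by (subst coef_bsum_reps) (auto simp: reps_def)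
qed

lemma coef_single_zp_sum: "coef (Poly_Mapping.single u c * zp_sum) g = (if fst g = fst u then c else 0)"
  by (auto simp: coef_single_mult coef_zp_sum)

lemma coef_bsum_zp_sum: "finite B \<Longrightarrow> coef (bsum B * zp_sum) g = int (card {u\<in>B. fst u = fst g})"
proof -
  assume B: "finite B"
  have "coef (bsum B * zp_sum) g = (\<Sum>u\<in>B. if fst u = fst g then 1 else 0)"
    by (auto simp: bsum_def sum_distrib_right coef_sum coef_single_zp_sum intro!: sum.cong)
  then show ?thesis using B by (simp add: sum.If_cases Int_def)
qed

lemma coef_zp_sum_zp_sum: "coef (x * (zp_sum * zp_sum)) g = int p * coef (x * zp_sum) g"
proof -
  have "coef (zp_sum * zp_sum) g = coef (of_nat p * zp_sum) g" for g
  proof -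
    have "coef (zp_sum * zp_sum) g = int (card {u\<in>{0} \<times> {0..<int p}. fst u = fst g})"
      by (subst zp_sum_def) (simp add: coef_bsum_zp_sum)
    also have "{u\<in>{0} \<times> {0..<int p}. fst u = fst g} = (if fst g = 0 then {0} \<times> {0..<int p} else {})"
      by auto
    finally show ?thesis by (simp add: coef_of_nat_mult coef_zp_sum)
  qed
  then have "coef (x * (zp_sum * zp_sum)) g = coef (x * (of_nat p * zp_sum)) g"
    using coef_mult_cong[of x x "zp_sum * zp_sum" "of_nat p * zp_sum"] by blast
  also have "x * (of_nat p * zp_sum) = of_nat p * (x * zp_sum)" by (simp add: mult_ac)
  finally show ?thesis by (simp add: coef_of_nat_mult)
qed

lemma cl_layer0: "cl (0, j) = (\<lambda>w. red (0, w * j)) ` W"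
proof (rule cl_eq[OF W_orb])
  show "red (0, j) \<in> (\<lambda>w. red (0, w * j)) ` W" using W_one by (intro image_eqI[of _ _ 1]) auto
qed

lemma rel_layer0: "rel (0, j) h \<longleftrightarrow> (\<exists>w\<in>W. red h = red (0, w * j))"
  using red_in_cl[of h "(0, j)"] unfolding cl_layer0 by auto

lemma rel_fst0: "rel g h \<Longrightarrow> fst g = 0 \<Longrightarrow> fst h = 0"
  using rel_layer0[of "snd g" h] by (metis fst_conv fst_red prod.collapse)

lemma int_schur_zp_sum: "zp_sum \<in> int_schur"
proof (rule int_schur_I)
  fix g h assume "rel g h"
  then have "fst g = 0 \<longleftrightarrow> fst h = 0" using rel_fst0 rel_sym by blast
  then show "coef zp_sum g = coef zp_sum h" by (simp add: coef_zp_sum)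
qed

definition layer_rel :: "int \<Rightarrow> int \<Rightarrow> bool" where
  "layer_rel i k \<longleftrightarrow> (\<exists>g h. rel g h \<and> fst g = i \<and> fst h = k)"

definition slice_card :: "zz set \<Rightarrow> int \<Rightarrow> nat" where
  "slice_card C i = card {u\<in>C. fst u = i}"

lemma LrI: "rel g h \<Longrightarrow> layer_rel (fst g) (fst h)" unfolding layer_rel_def by blast
lemma layer_rel_refl [simp]: "layer_rel i i" using LrI[of "(i,0)" "(i,0)"] by simp
lemma layer_rel_sym: "layer_rel i k \<Longrightarrow> layer_rel k i" unfolding layer_rel_def using rel_sym by blast

lemma slice_card_pos: "slice_card (cl g) i > 0 \<longleftrightarrow> (\<exists>h. rel g h \<and> fst h = i)"
proof
  assume "slice_card (cl g) i > 0"
  then have "{u\<in>cl g. fst u = i} \<noteq> {}" unfolding slice_card_def by (metis card.empty less_nat_zero_code)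
  then show "\<exists>h. rel g h \<and> fst h = i" using cl_rel by blast
next
  assume "\<exists>h. rel g h \<and> fst h = i"
  then obtain h where "rel g h" "fst h = i" by blast
  then have "red h \<in> {u\<in>cl g. fst u = i}" by simp
  then have "{u\<in>cl g. fst u = i} \<noteq> {}" by blast
  then show "slice_card (cl g) i > 0" unfolding slice_card_def by (simp add: card_gt_0_iff)
qed

lemma slice_card_self: "slice_card (cl g) (fst g) > 0"
  using slice_card_pos rel_refl by blast

text \<open>Multiplication by \<open>zp_sum\<close> turns the class sum of \<open>a\<close> into the
  function that gives the slice size over each layer. It is constant on the class that links i and
  k, which may be a different class from that of \<open>a\<close>.\<close>

lemma slice_card_layer_rel: "layer_rel i k \<Longrightarrow> slice_card (cl a) i = slice_card (cl a) k"
proof -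
  assume "layer_rel i k"
  then obtain g h where gh: "rel g h" "fst g = i" "fst h = k" by (auto simp: layer_rel_def)
  have "bsum (cl a) * zp_sum \<in> int_schur" by (intro int_schur_mult int_schur_bsum_cl int_schur_zp_sum)
  from int_schur_D[OF this gh(1)] gh(2,3) show ?thesis by (simp add: coef_bsum_zp_sum slice_card_def)
qed

text \<open>One class linking two layers forces every class that meets one of them to meet the
  other; this makes \<open>layer_rel\<close> transitive.\<close>

lemma layer_rel_lift: "layer_rel (fst g) k \<Longrightarrow> \<exists>h. rel g h \<and> fst h = k"
  using slice_card_layer_rel[of "fst g" k g] slice_card_self[of g] slice_card_pos[of g k] by simp

lemma layer_rel_trans: "layer_rel i k \<Longrightarrow> layer_rel k l \<Longrightarrow> layer_rel i l"
proof -
  assume "layer_rel i k" "layer_rel k l"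
  then obtain g h where gh: "rel g h" "fst g = i" "fst h = k" by (auto simp: layer_rel_def)
  obtain h' where "rel h h'" "fst h' = l" using layer_rel_lift[of h l] \<open>layer_rel k l\<close> gh by auto
  then show ?thesis using gh rel_trans unfolding layer_rel_def by blast
qed

lemma layer_rel_uminus: "layer_rel i k \<Longrightarrow> layer_rel (- i) (- k)"
  unfolding layer_rel_def using rel_uminus by (metis fst_uminus)

lemma layer_rel_0: "layer_rel 0 k \<longleftrightarrow> k = 0"
  using rel_fst0 layer_rel_refl[of 0] unfolding layer_rel_def by blast

lemma finite_layer_rel: "finite {l. layer_rel i l}"
proof -
  have "{l. layer_rel i l} \<subseteq> fst ` cl (i, 0)"
  proof
    fix l assume "l \<in> {l. layer_rel i l}"
    then obtain h where "rel (i,0) h" "fst h = l" using layer_rel_lift[of "(i,0)" l] by auto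
    then show "l \<in> fst ` cl (i, 0)" by (intro image_eqI[of _ _ "red h"]) auto
  qed
  then show ?thesis by (meson cl_finite finite_imageI finite_subset)
qed

text \<open>One point over each element of \<open>E\<close>; the product with \<open>zp_sum\<close>
  is the sum of the full layers.\<close>

definition layer_sum :: "int set \<Rightarrow> zring" where "layer_sum E = bsum (E \<times> {0})"

lemma coef_layer_sum: "finite E \<Longrightarrow> coef (layer_sum E * zp_sum) g = (if fst g \<in> E then 1 else 0)"
proof -
  assume "finite E"
  moreover have "{u\<in>E \<times> {0::int}. fst u = fst g} = (if fst g \<in> E then {(fst g, 0)} else {})" by auto
  ultimately have "coef (layer_sum E * zp_sum) g = int (card (if fst g \<in> E then {(fst g, 0::int)} else {}))"
    unfolding layer_sum_def by (subst coef_bsum_zp_sum) simp_all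
  then show ?thesis by simp
qed

lemma layer_sum_int_schur:
  assumes "finite E" "\<And>i k. i \<in> E \<Longrightarrow> layer_rel i k \<Longrightarrow> k \<in> E"
  shows "layer_sum E * zp_sum \<in> int_schur"
proof (rule int_schur_I)
  fix g h assume "rel g h"
  then have "fst g \<in> E \<longleftrightarrow> fst h \<in> E" using assms(2) LrI rel_sym by blast
  then show "coef (layer_sum E * zp_sum) g = coef (layer_sum E * zp_sum) h" by (simp add: coef_layer_sum assms(1))
qed

text \<open>The product contains \<open>zp_sum\<close> twice, which amounts to a factor p that the
  integers allow to be cancelled. In this way the multiples of \<open>zp_sum\<close> serve as a
  Schur ring over Z.\<close>

lemma int_schur_zp_sum_mult: assumes "x * zp_sum \<in> int_schur" "y * zp_sum \<in> int_schur" shows "x * y * zp_sum \<in> int_schur"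
proof (rule int_schur_I)
  fix g h assume gh: "rel g h"
  have eq: "(x * zp_sum) * (y * zp_sum) = x * y * (zp_sum * zp_sum)" by (simp add: mult_ac)
  have "coef (x * y * (zp_sum * zp_sum)) g = coef (x * y * (zp_sum * zp_sum)) h"
    using int_schur_D[OF int_schur_mult[OF assms] gh] unfolding eq .
  then show "coef (x * y * zp_sum) g = coef (x * y * zp_sum) h"
    using p_nz by (simp add: coef_zp_sum_zp_sum)
qed

lemma int_schur_zp_sum_power: assumes "x * zp_sum \<in> int_schur" shows "x ^ n * zp_sum \<in> int_schur"
  by (induction n) (use int_schur_zp_sum int_schur_zp_sum_mult[OF assms] in auto)

text \<open>The argument of \<open>mult_prime\<close>, carried out over Z. Since Z is torsion-free,
  q = p is allowed here.\<close>

lemma qmult_prime: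
  assumes "Factorial_Ring.prime q" "layer_rel (int q * i) k"
  shows "\<exists>l. layer_rel i l \<and> k = int q * l"
proof (rule ccontr)
  assume no: "\<not> ?thesis"
  define E where "E = {l. layer_rel i l}"
  have fE: "finite E" unfolding E_def by (rule finite_layer_rel)
  have S: "layer_sum E ^ q * zp_sum \<in> int_schur"
    using layer_rel_trans by (intro int_schur_zp_sum_power layer_sum_int_schur fE) (auto simp: E_def)
  have q0: "q > 0" using assms(1) prime_gt_0_nat by blast
  obtain r where r: "layer_sum E ^ q = (\<Sum>u\<in>E \<times> {0}. Poly_Mapping.single (scale (int q) u) 1) + of_nat q * r"
    using bsum_power_prime[OF assms(1), of "E \<times> {0}"] fE unfolding layer_sum_def by auto
  have c: "coef (layer_sum E ^ q * zp_sum) g = int (card {u\<in>E \<times> {0::int}. fst g = int q * fst u}) + int q * coef (r * zp_sum) g" for g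
  proof -
    have "coef (layer_sum E ^ q * zp_sum) g = (\<Sum>u\<in>E \<times> {0::int}. if fst g = int q * fst u then 1 else 0) + int q * coef (r * zp_sum) g"
      by (simp add: r ring_distribs coef_add sum_distrib_right coef_sum coef_single_zp_sum mult.assoc coef_of_nat_mult)
    then show ?thesis using fE by (simp add: sum.If_cases Int_def)
  qed
  \<comment> \<open>Only i itself is sent to q i, so the coefficient there is 1 modulo q, while over
    k it is 0 modulo q.\<close>
  have "{u\<in>E \<times> {0::int}. fst (int q * i, 0::int) = int q * fst u} = {(i, 0)}"
    using q0 by (auto simp: E_def)
  then have c1: "coef (layer_sum E ^ q * zp_sum) (int q * i, 0) = 1 + int q * coef (r * zp_sum) (int q * i, 0)"
    by (subst c) simp
  obtain h where h: "rel (int q * i, 0) h" "fst h = k" using layer_rel_lift[of "(int q * i, 0)" k] assms(2) by auto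
  have emp: "{u\<in>E \<times> {0::int}. fst h = int q * fst u} = {}" using no h(2) by (auto simp: E_def)
  have c2: "coef (layer_sum E ^ q * zp_sum) h = int q * coef (r * zp_sum) h"
    unfolding c emp by simp
  have "1 = int q * (coef (r * zp_sum) h - coef (r * zp_sum) (int q * i, 0))"
    using c1 c2 int_schur_D[OF S h(1)] by (simp add: right_diff_distrib)
  then have "int q dvd 1" by (metis dvd_triv_left)
  then show False using assms(1) prime_gt_1_nat by fastforce
qed

lemma qmult_nat:
  assumes "n > 0" "layer_rel (int n * i) k"
  shows "\<exists>l. layer_rel i l \<and> k = int n * l"
  using assms
proof (induction n arbitrary: i k rule: less_induct)
  case (less n)
  show ?case
  proof (cases "n = 1")
    case True
    then show ?thesis using less.prems by auto
  next
    case False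
    then obtain q where q: "Factorial_Ring.prime q" "q dvd n" using prime_factor_nat by blast
    then obtain m where m: "n = q * m" by (auto elim: dvdE)
    have m': "m > 0" "m < n" using less.prems(1) m prime_gt_1_nat[OF q(1)] by auto
    have "layer_rel (int q * (int m * i)) k" using less.prems(2) m by (simp add: mult.assoc)
    from qmult_prime[OF q(1) this] obtain l where l: "layer_rel (int m * i) l" "k = int q * l" by blast
    from less.IH[OF m'(2,1) l(1)] obtain l' where l': "layer_rel i l'" "l = int m * l'" by blast
    then show ?thesis using l m by auto
  qed
qed

lemma qmult:
  assumes "n \<noteq> 0" "layer_rel (n * i) k"
  shows "\<exists>l. layer_rel i l \<and> k = n * l"
proof (cases "n > 0")
  case True
  then show ?thesis using qmult_nat[of "nat n" i k] assms by auto
next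
  case False
  have "layer_rel (- n * i) (- k)" using layer_rel_uminus[OF assms(2)] by simp
  then have "\<exists>l. layer_rel i l \<and> - k = - n * l" using qmult_nat[of "nat (- n)" i "- k"] assms(1) False by auto
  then show ?thesis by auto
qed

text \<open>If 1 is linked to e, the link read backwards from e * 1 to 1 makes 1 a multiple of e, so
  e is a unit of the integers. Any other nonzero layer is a multiple of layer 1.\<close>

lemma layer_rel_pm: "layer_rel n k \<Longrightarrow> k = n \<or> k = - n"
proof -
  assume nk: "layer_rel n k"
  have one: "e = 1 \<or> e = -1" if e1: "layer_rel 1 e" for e
  proof -
    have "e \<noteq> 0"
    proof
      assume "e = 0"
      then show False using layer_rel_sym[OF e1] layer_rel_0[of 1] by simp
    qed
    then obtain l where "1 = e * l" using qmult[of e 1 1] layer_rel_sym[OF e1] by auto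
    then show ?thesis using zmult_eq_1_iff by metis
  qed
  show ?thesis
  proof (cases "n = 0")
    case True then show ?thesis using nk layer_rel_0 by auto
  next
    case False
    then have "\<exists>l. layer_rel 1 l \<and> k = n * l" using qmult[of n 1 k] nk by simp
    then obtain l where l: "layer_rel 1 l" "k = n * l" by blast
    from one[OF l(1)] l(2) show ?thesis by (elim disjE) simp_all
  qed
qed

lemma rel_pm: "rel g h \<Longrightarrow> fst h = fst g \<or> fst h = - fst g"
  using layer_rel_pm LrI by blast

text \<open>A one-sided layer \<open>k\<close> forces layer \<open>k + 1\<close>, hence also layer \<open>1\<close>, to be one-sided.\<close>

lemma layer_rel_uniform: "layer_rel 1 (-1) \<Longrightarrow> layer_rel k (- k)"
proof (rule ccontr)
  assume 1: "layer_rel 1 (-1)" and no: "\<not> layer_rel k (- k)"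
  have k0: "k \<noteq> 0" using no by auto
  have one_sided: "layer_sum {i} * zp_sum \<in> int_schur" if "\<not> layer_rel i (- i)" for i
    using that layer_rel_pm by (intro layer_sum_int_schur) auto
  have "layer_sum {1, -1} * zp_sum \<in> int_schur" using layer_rel_pm[of 1] layer_rel_pm[of "-1"] by (intro layer_sum_int_schur) auto
  from int_schur_zp_sum_mult[OF one_sided[OF no] this]
  have S: "layer_sum {k} * layer_sum {1, -1} * zp_sum \<in> int_schur" .
  have layer_sum_mult: "layer_sum {i} * y = Poly_Mapping.single (i, 0) 1 * y" for i y
    by (simp add: layer_sum_def bsum_def)
  have c: "coef (layer_sum {k} * layer_sum {1, -1} * zp_sum) g = (if fst g = k + 1 \<or> fst g = k - 1 then 1 else 0)" for g
    by (simp add: mult.assoc layer_sum_mult coef_single_mult coef_layer_sum)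
  have "\<not> layer_rel (k + 1) (- (k + 1))"
  proof
    assume "layer_rel (k + 1) (- (k + 1))"
    then have "\<exists>h. rel (k + 1, 0) h \<and> fst h = - (k + 1)" using layer_rel_lift[of "(k + 1, 0)"] by simp
    then obtain h where "rel (k + 1, 0) h" "fst h = - (k + 1)" by blast
    \<comment> \<open>The product is supported on k + 1 and k - 1. A partner - (k + 1) equal to one
      of these leaves only k = -1 or k = 0.\<close>
    then have "- (k + 1) = k + 1 \<or> - (k + 1) = k - 1" using int_schur_D[OF S, of "(k + 1, 0)" h] by (auto simp: c split: if_splits)
    then have "k = -1" using k0 by auto
    then show False using no layer_rel_sym[OF 1] by simp
  qed
  moreover have "\<not> layer_rel (- k) k" using no layer_rel_sym by auto
  ultimately have "layer_sum {k + 1} * layer_sum {- k} * zp_sum \<in> int_schur"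
    using one_sided[of "k + 1"] one_sided[of "- k"] by (intro int_schur_zp_sum_mult) auto
  moreover have "coef (layer_sum {k + 1} * layer_sum {- k} * zp_sum) g = (if fst g = 1 then 1 else 0)" for g
    by (simp add: mult.assoc layer_sum_mult coef_single_mult coef_zp_sum)
  moreover have "\<exists>h. rel (1, 0) h \<and> fst h = -1" using layer_rel_lift[of "(1, 0)"] 1 by simp
  then obtain h where "rel (1, 0) h" "fst h = -1" by blast
  ultimately show False using int_schur_D[of "layer_sum {k + 1} * layer_sum {- k} * zp_sum" "(1, 0)" h] by simp
qed

section \<open>Full layers and the wedge product\<close>

lemma S_subgroupI:
  assumes "subgroup K (ZxZp p)" "\<And>g h. rel g h \<Longrightarrow> red g \<in> K \<Longrightarrow> red h \<in> K"
  shows "S_subgroup (ZxZp p) D K"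
  unfolding S_subgroup_def
proof (intro conjI ballI)
  fix C assume C: "C \<in> D"
  show "C \<subseteq> K \<or> C \<inter> K = {}"
  proof (rule ccontr)
    assume "\<not> ?thesis"
    then obtain u v where uv: "u \<in> C" "u \<in> K" "v \<in> C" "v \<notin> K" by blast
    then have "red u = u" "red v = v" using D_red C by blast+
    moreover from this have "rel u v" unfolding rel_def using C uv by auto
    ultimately show False using assms(2)[of u v] uv by simp
  qed
qed (rule assms(1))

text \<open>The negation says that layer i lies inside a single class, which then contains a full
  coset of Z_p.\<close>

definition proper_layer :: "int \<Rightarrow> bool" where
  "proper_layer i \<longleftrightarrow> (\<exists>g h. fst g = i \<and> fst h = i \<and> \<not> rel g h)"

lemma slice_card_sub: "{u\<in>cl g. fst u = i} \<subseteq> {i} \<times> {0..<int p}"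
  using cl_reps[of g] by (auto simp: reps_def)

lemma slice_card_le: "slice_card (cl g) i \<le> p"
proof -
  have "slice_card (cl g) i \<le> card ({i} \<times> {0..<int p})" unfolding slice_card_def by (intro card_mono slice_card_sub) simp
  then show ?thesis by (simp add: card_cartesian_product)
qed

lemma proper_layer_slice_card: "proper_layer (fst g) \<Longrightarrow> slice_card (cl g) (fst g) < p"
proof (rule ccontr)
  assume proper_layer: "proper_layer (fst g)" and "\<not> slice_card (cl g) (fst g) < p"
  then have "slice_card (cl g) (fst g) = p" using slice_card_le[of g "fst g"] by simp
  then have eq: "{u\<in>cl g. fst u = fst g} = {fst g} \<times> {0..<int p}"
    unfolding slice_card_def by (intro card_subset_eq slice_card_sub) (auto simp: card_cartesian_product)
  have r: "rel g h" if "fst h = fst g" for h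
  proof -
    have "red h \<in> {fst g} \<times> {0..<int p}" using that by (auto simp: red_def)
    then have "red h \<in> {u\<in>cl g. fst u = fst g}" using eq by simp
    then have "red h \<in> cl g" by simp
    then show ?thesis by simp
  qed
  from proper_layer obtain h h' where "fst h = fst g" "fst h' = fst g" "\<not> rel h h'" unfolding proper_layer_def by blast
  then show False using rel_trans[OF rel_sym[OF r] r] by blast
qed

lemma proper_layer_0: "proper_layer 0"
proof -
  have "\<not> rel 0 (0, 1)"
  proof
    assume "rel 0 (0, 1)"
    then have "red (0, 1) = 0" using red_in_cl[of "(0,1)" 0] cl_0 by simp
    then show False using p_gt1 by (simp add: red_def zero_prod_def)
  qed
  moreover have "fst (0::zz) = 0" "fst (0::int, 1::int) = 0" by simp_all
  ultimately show ?thesis unfolding proper_layer_def by blast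
qed

lemma proper_layer_uminus: "proper_layer i \<Longrightarrow> proper_layer (- i)"
proof -
  assume "proper_layer i"
  then obtain g h where gh: "fst g = i" "fst h = i" "\<not> rel g h" unfolding proper_layer_def by blast
  then have "\<not> rel (- g) (- h)" using rel_uminus[of "- g" "- h"] by auto
  moreover have "fst (- g) = - i" "fst (- h) = - i" using gh by simp_all
  ultimately show ?thesis unfolding proper_layer_def by blast
qed

lemma slice_card_supp: "slice_card (cl g) k \<noteq> 0 \<Longrightarrow> k = fst g \<or> k = - fst g"
proof -
  assume "slice_card (cl g) k \<noteq> 0"
  then obtain h where "rel g h" "fst h = k" using slice_card_pos[of g k] by blast
  then show ?thesis using rel_pm[of g h] by simp
qed

text \<open>If layer j + k lay inside one class, the product of class sums over j and k would have
  constant coefficients there, with a total divisible by p. But that total is a product of two slice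
  sizes strictly between 0 and p.\<close>

lemma proper_layer_add: assumes "proper_layer j" "proper_layer k" shows "proper_layer (j + k)"
\<comment> \<open>Outside these cases the only way to reach j + k from j or -j and k or -k is j plus
  k, so a single pair of slices contributes.\<close>
proof (cases "j = 0 \<or> k = 0 \<or> j + k = 0")
  case True
  then show ?thesis using assms proper_layer_0 by auto
next
  case False
  show ?thesis
  proof (rule ccontr)
    assume no: "\<not> proper_layer (j + k)"
    define A B where "A = cl (j, 0)" and "B = cl (k, 0)"
    define g :: zz where "g = (j + k, 0)"
    define x where "x = bsum A * bsum B"
    have xS: "x \<in> int_schur" unfolding x_def A_def B_def by (intro int_schur_mult int_schur_bsum_cl)
    have "coef (zp_sum * x) g = (\<Sum>u\<in>{0} \<times> {0..<int p}. coef x (g - u))"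
      unfolding zp_sum_def by (rule coef_bsum_mult_left)
    also have "\<dots> = (\<Sum>u\<in>{0::int} \<times> {0..<int p}. coef x g)"
    proof (rule sum.cong)
      fix u :: zz assume "u \<in> {0} \<times> {0..<int p}"
      then have "fst (g - u) = j + k" "fst g = j + k" by (auto simp: g_def)
      then have "rel (g - u) g" using no unfolding proper_layer_def by blast
      then show "coef x (g - u) = coef x g" using int_schur_D[OF xS] by blast
    qed simp
    also have "\<dots> = int p * coef x g" by (simp add: card_cartesian_product)
    finally have 1: "coef (zp_sum * x) g = int p * coef x g" .
    have "coef (zp_sum * x) g = coef (bsum A * (bsum B * zp_sum)) g" by (simp add: x_def mult_ac)
    also have "\<dots> = (\<Sum>u\<in>A. coef (bsum B * zp_sum) (g - u))" by (rule coef_bsum_mult_left)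
    also have "\<dots> = (\<Sum>u\<in>A. if fst u = j then int (slice_card B k) else 0)"
    proof (rule sum.cong)
      fix u assume "u \<in> A"
      then have "fst u = j \<or> fst u = - j" using rel_pm[of "(j, 0)" u] cl_rel[of u "(j, 0)"] by (simp add: A_def)
      moreover have "slice_card B (j + k + j) = 0"
      proof (rule ccontr)
        assume "slice_card B (j + k + j) \<noteq> 0"
        then have "j + k + j = k \<or> j + k + j = - k" using slice_card_supp[of "(k, 0)" "j + k + j"] by (simp add: B_def)
        then show False using False by auto
      qed
      moreover have "coef (bsum B * zp_sum) (g - u) = int (slice_card B (j + k - fst u))"
        unfolding B_def by (simp add: coef_bsum_zp_sum slice_card_def g_def)
      ultimately show "coef (bsum B * zp_sum) (g - u) = (if fst u = j then int (slice_card B k) else 0)"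
        using False by auto
    qed simp
    also have "\<dots> = int (slice_card A j * slice_card B k)"
      by (simp add: sum.If_cases A_def slice_card_def Int_def)
    finally have "int p dvd int (slice_card A j * slice_card B k)" using 1 by (metis dvd_triv_left)
    then have "p dvd slice_card A j * slice_card B k" by presburger
    then have "p dvd slice_card A j \<or> p dvd slice_card B k" using prime_p prime_dvd_mult_iff by blast
    moreover have "0 < slice_card A j" "slice_card A j < p" "0 < slice_card B k" "slice_card B k < p"
      using slice_card_self[of "(j,0)"] slice_card_self[of "(k,0)"] proper_layer_slice_card[of "(j,0)"] proper_layer_slice_card[of "(k,0)"] assms
      by (simp_all add: A_def B_def)
    ultimately show False by (auto dest: dvd_imp_le)
  qed
qed

text \<open>\<open>L\<close> lies over the subgroup of proper layers. Layer i keeps it from being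
  the whole group, and each layer outside it belongs to one class, which therefore contains its
  coset of Z_p.\<close>

lemma wedge_if_full:
  assumes "\<not> proper_layer i"
  shows "wedge_product (ZxZp p) D"
proof -
  define K :: "zz set" where "K = {0} \<times> {0..<int p}"
  define L where "L = {g\<in>reps. proper_layer (fst g)}"
  have nfpm: "proper_layer (fst g) \<Longrightarrow> rel g h \<Longrightarrow> proper_layer (fst h)" for g h
    using rel_pm[of g h] proper_layer_uminus by auto
  have K: "subgroup K (ZxZp p)"
    by (rule subgroup_ZxZpI) (auto simp: K_def reps_def red_def zero_prod_def)
  have SK: "S_subgroup (ZxZp p) D K"
  proof (rule S_subgroupI[OF K])
    fix g h assume "rel g h" "red g \<in> K"
    then have "fst h = 0" using rel_fst0[of g h] by (auto simp: K_def red_def)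
    then show "red h \<in> K" by (auto simp: K_def red_def)
  qed
  have SL: "S_subgroup (ZxZp p) D L"
  proof (rule S_subgroupI)
    show "subgroup L (ZxZp p)"
      by (rule subgroup_ZxZpI) (auto simp: L_def proper_layer_0 proper_layer_add proper_layer_uminus, auto simp: reps_def zero_prod_def)
  qed (use nfpm in \<open>simp add: L_def\<close>)
  have e1: "(0, 1) \<in> K" "(0, 1) \<in> L" using proper_layer_0 p_gt1 by (auto simp: K_def L_def reps_def)
  have e2: "(i, 0) \<notin> L" "(i, 0) \<in> reps" "(i, 0) \<notin> K"
    using assms proper_layer_0 p_gt1 by (auto simp: L_def reps_def K_def)
  have KL: "K \<subseteq> L" using proper_layer_0 by (auto simp: K_def L_def reps_def)
  have norm: "K \<lhd> ZxZp p" by (rule comm_group.normal_iff_subgroup[OF comm_group_ZxZp, THEN iffD2, OF K])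
  have cos: "c <#\<^bsub>ZxZp p\<^esub> K \<subseteq> C" if C: "C \<in> D" "\<not> C \<subseteq> L" "c \<in> C" for C c
  proof
    fix x assume "x \<in> c <#\<^bsub>ZxZp p\<^esub> K"
    then obtain k where k: "k \<in> K" "x = red (c + k)" by (auto simp: l_coset_def)
    have "C \<inter> L = {}" using SL C unfolding S_subgroup_def by blast
    then have "\<not> proper_layer (fst c)" using C D_reps by (auto simp: L_def)
    moreover have "fst x = fst c" using k by (auto simp: K_def)
    ultimately have "rel c x" unfolding proper_layer_def by blast
    then have "red x \<in> cl c" by simp
    moreover have "C = cl c" using D_cl C by blast
    moreover have "red x = x" using k by simp
    ultimately show "x \<in> C" by simp
  qed
  have ne: "K \<noteq> {0}" "L \<noteq> {0}" "K \<noteq> reps" "L \<noteq> reps"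
    using e1 e2 by (auto simp: zero_prod_def)
  show ?thesis
    unfolding wedge_product_def
    by (intro exI[of _ K] exI[of _ L]) (use SK SL KL norm cos ne in simp)
qed

section \<open>Classes of p-th powers\<close>

text \<open>Multiplication by p forgets the Z_p-coordinate, so the whole slice over i is sent to the
  single point (p i, 0), where the coefficient becomes the slice size, nonzero modulo p. Every
  \<open>h\<close> in the class of that point must also be hit, and the class of (i, 0) has only the
  layers i and -i to offer.\<close>

lemma rel_p_mult:
  assumes "proper_layer i" "rel (int p * i, 0) h"
  shows "red h = (int p * i, 0) \<or> red h = (- (int p * i), 0)"
proof (rule ccontr)
  assume no: "\<not> ?thesis"
  let ?A = "cl (i, 0)"
  have red_p: "red (scale (int p) u) = (int p * fst u, 0)" for u by (simp add: red_def)
  have d: "int p dvd coef (bsum ?A ^ p) g - int (card {u\<in>?A. red (scale (int p) u) = red g})" for g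
    using prime_p by (intro coef_bsum_power_prime) simp_all
  have "{u\<in>?A. red (scale (int p) u) = red (int p * i, 0)} = {u\<in>?A. fst u = i}"
    using p_gt1 by (auto simp: red_def)
  then have 1: "int p dvd coef (bsum ?A ^ p) (int p * i, 0) - int (slice_card ?A i)"
    using d[of "(int p * i, 0)"] by (simp add: slice_card_def)
  have emp: "{u\<in>?A. red (scale (int p) u) = red h} = {}"
  proof (rule ccontr)
    assume "\<not> ?thesis"
    then obtain u where u: "u \<in> ?A" "red h = (int p * fst u, 0)" using red_p by auto
    then have "fst u = i \<or> fst u = - i" using rel_pm[OF cl_rel[OF u(1)]] by simp
    then show False using no u(2) by auto
  qed
  then have "int p dvd coef (bsum ?A ^ p) h" using d[of h] unfolding emp by simp
  moreover have "coef (bsum ?A ^ p) (int p * i, 0) = coef (bsum ?A ^ p) h"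
    by (rule int_schur_D[OF int_schur_power[OF int_schur_bsum_cl] assms(2)])
  ultimately have "int p dvd int (slice_card ?A i)" using 1 by (simp add: dvd_diff_right_iff)
  then have "p dvd slice_card ?A i" by presburger
  moreover have "0 < slice_card ?A i" "slice_card ?A i < p" using slice_card_self[of "(i,0)"] proper_layer_slice_card[of "(i,0)"] assms(1) by simp_all
  ultimately show False by (auto dest: dvd_imp_le)
qed

lemma S_subgroup_p_mult:
  assumes "\<And>i. proper_layer i"
  shows "S_subgroup (ZxZp p) D (range (\<lambda>i. (int p * i, 0)))"
proof (rule S_subgroupI)
  show "subgroup (range (\<lambda>i. (int p * i, 0))) (ZxZp p)"
  proof (rule subgroup_ZxZpI)
    show "(range (\<lambda>i. (int p * i, 0))) \<subseteq> reps" by (auto simp: reps_def)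
    show "0 \<in> range (\<lambda>i. (int p * i, 0))" by (intro range_eqI[of _ _ 0]) (simp add: zero_prod_def)
    fix u v :: zz assume u: "u \<in> range (\<lambda>i. (int p * i, 0))"
    then obtain a where a: "u = (int p * a, 0)" by blast
    then show "red (- u) \<in> range (\<lambda>i. (int p * i, 0))" by (intro range_eqI[of _ _ "- a"]) (simp add: red_def)
    assume "v \<in> range (\<lambda>i. (int p * i, 0))"
    then obtain b where "v = (int p * b, 0)" by blast
    then show "red (u + v) \<in> range (\<lambda>i. (int p * i, 0))" using a
      by (intro range_eqI[of _ _ "a + b"]) (simp add: red_def distrib_left)
  qed
  fix g h assume gh: "rel g h" "red g \<in> range (\<lambda>i. (int p * i, 0))"
  then obtain i where "red g = (int p * i, 0)" by blast
  then have "rel (int p * i, 0) h" using gh(1) rel_red1[of g h] by simp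
  from rel_p_mult[OF assms this] show "red h \<in> range (\<lambda>i. (int p * i, 0))"
  proof
    assume "red h = (- (int p * i), 0)"
    then show ?thesis by (intro range_eqI[of _ _ "- i"]) simp
  qed auto
qed

section \<open>Counting the classes over one layer\<close>

abbreviation m :: nat where "m \<equiv> card W"

definition layer_classes :: "int \<Rightarrow> zz set set" where
  "layer_classes i = cl ` ({i} \<times> {0..<int p})"

lemma finite_layer_classes [simp]: "finite (layer_classes i)" by (simp add: layer_classes_def)

lemma cl_in_layer_classes: "cl g \<in> layer_classes (fst g)"
proof -
  have "cl g = cl (red g)" by (intro cl_cong) simp
  moreover have "red g \<in> {fst g} \<times> {0..<int p}" by (auto simp: red_def)
  then have "cl (red g) \<in> cl ` ({fst g} \<times> {0..<int p})" by (rule imageI)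
  ultimately show ?thesis by (simp add: layer_classes_def)
qed

lemma layer_classesE:
  assumes "C \<in> layer_classes i" obtains g where "fst g = i" "g \<in> reps" "C = cl g"
  using assms unfolding layer_classes_def reps_def by force

lemma card_orbit: "j \<in> {1..<int p} \<Longrightarrow> card (cl (0, j)) = m"
proof -
  assume j: "j \<in> {1..<int p}"
  have "inj_on (\<lambda>w. red (0, w * j)) W"
  proof (rule inj_onI)
    fix v w assume vw: "v \<in> W" "w \<in> W" "red (0, v * j) = red (0, w * j)"
    have "\<not> int p dvd j" using j zdvd_not_zless by fastforce
    then have "red (0, v) = red (0, w)"
      using red_scale_inj[of j "(0, v)" "(0, w)"] vw(3) j by (simp add: scale_def mult.commute)
    moreover have "red (0, v) = (0, v)" "red (0, w) = (0, w)" using vw(1,2) W_sub by (auto simp: red_def)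
    ultimately show "v = w" by simp
  qed
  then show ?thesis by (simp add: cl_layer0 card_image)
qed

text \<open>Both conclusions come from the same partition \<open>Q\<close> of the nonzero elements
  of Z_p into classes of size m.\<close>

lemma sum_layer0:
  fixes f :: "zz \<Rightarrow> int"
  assumes "\<And>g h. rel g h \<Longrightarrow> f g = f h"
  shows "int m dvd (\<Sum>u\<in>{0} \<times> {1..<int p}. f u)"
    and "(card (layer_classes 0) - 1) * m = p - 1"
proof -
  define Q where "Q = cl ` ({0} \<times> {1..<int p})"
  have no0: "cl 0 \<notin> Q"
  proof
    assume "cl 0 \<in> Q"
    then obtain j where j: "j \<in> {1..<int p}" "cl 0 = cl (0, j)" unfolding Q_def by auto
    have "red (0, j) \<in> cl (0, j)" by simp
    then have "red (0, j) = 0" unfolding j(2)[symmetric] cl_0 by simp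
    then show False using j(1) by (simp add: red_def zero_prod_def)
  qed
  have U: "\<Union>Q = {0} \<times> {1..<int p}"
  proof (intro equalityI subsetI)
    fix u assume "u \<in> \<Union>Q"
    then obtain j where j: "j \<in> {1..<int p}" "u \<in> cl (0, j)" unfolding Q_def by blast
    then have u: "fst u = 0" "u \<in> reps" "cl u = cl (0, j)"
      using rel_fst0[OF cl_rel[OF j(2)]] cl_reps cl_cong[OF cl_rel[OF j(2)]] by auto
    have "cl u \<in> Q" unfolding u(3) Q_def using j(1) by blast
    then have "u \<noteq> 0" using no0 by auto
    then show "u \<in> {0} \<times> {1..<int p}" using u(1,2) by (cases u) (auto simp: reps_def zero_prod_def)
  next
    fix u :: zz assume u: "u \<in> {0} \<times> {1..<int p}"
    then have "u \<in> reps" by (auto simp: reps_def)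
    then have "u \<in> cl u" using cl_iff red_id by simp
    then show "u \<in> \<Union>Q" using u unfolding Q_def by blast
  qed
  have disj: "C \<inter> C' = {}" if "C \<in> Q" "C' \<in> Q" "C \<noteq> C'" for C C'
  proof -
    have "C \<in> D" "C' \<in> D" using that cl_D unfolding Q_def by blast+
    then show ?thesis using D_disj that(3) by blast
  qed
  have finQ: "finite Q" "\<forall>C\<in>Q. finite C" unfolding Q_def by auto
  have cardQ: "card C = m" if "C \<in> Q" for C using that card_orbit unfolding Q_def by auto
  have "(\<Sum>u\<in>\<Union>Q. f u) = (\<Sum>C\<in>Q. \<Sum>u\<in>C. f u)"
    using sum.Union_disjoint[OF finQ(2), of f] disj by simp
  also have "int m dvd \<dots>"
  proof (rule dvd_sum)
    fix C assume C: "C \<in> Q"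
    then obtain j where j: "C = cl (0, j)" unfolding Q_def by blast
    have "(\<Sum>u\<in>C. f u) = (\<Sum>u\<in>C. f (0, j))"
      using assms cl_rel rel_sym j by (intro sum.cong) blast+
    then show "int m dvd (\<Sum>u\<in>C. f u)" using cardQ[OF C] by simp
  qed
  finally show "int m dvd (\<Sum>u\<in>{0} \<times> {1..<int p}. f u)" unfolding U .
  have "card (\<Union>Q) = (\<Sum>C\<in>Q. card C)"
    using disj finQ by (intro card_Union_disjoint) (auto simp: pairwise_def disjnt_def)
  then have c: "p - 1 = card Q * m" using cardQ unfolding U by (simp add: card_cartesian_product)
  have "{0::int} \<times> {0..<int p} = insert 0 ({0} \<times> {1..<int p})" using p_gt1 by (auto simp: zero_prod_def)
  then have "layer_classes 0 = insert (cl 0) Q" unfolding layer_classes_def Q_def by simp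
  then have "card (layer_classes 0) = Suc (card Q)" using no0 finQ by simp
  then show "(card (layer_classes 0) - 1) * m = p - 1" using c by simp
qed

lemma card_cl_uminus: "card (cl (- c)) = card (cl c)"
proof -
  have "cl (- c) = (\<lambda>u. red (- u)) ` cl c"
  proof (intro equalityI subsetI)
    fix v assume v: "v \<in> cl (- c)"
    then have "rel c (- v)" using rel_uminus[OF cl_rel[OF v]] by simp
    moreover have "red (- red (- v)) = red (- (- v))" by (rule red_uminus_cong) simp
    then have "v = red (- red (- v))" using cl_red[OF v] by simp
    ultimately show "v \<in> (\<lambda>u. red (- u)) ` cl c" by (intro image_eqI[of _ _ "red (- v)"]) simp_all
  next
    fix v assume "v \<in> (\<lambda>u. red (- u)) ` cl c"
    then obtain u where u: "u \<in> cl c" "v = red (- u)" by blast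
    then show "v \<in> cl (- c)" using rel_uminus[OF cl_rel[OF u(1)]] by simp
  qed
  moreover have "inj_on (\<lambda>u. red (- u)) (cl c)"
  proof (rule inj_onI)
    fix u v assume uv: "u \<in> cl c" "v \<in> cl c" "red (- u) = red (- v)"
    then show "u = v" using red_uminus_cong[OF uv(3)] cl_red by simp
  qed
  ultimately show ?thesis by (simp add: card_image)
qed

text \<open>A double count of the coefficients of \<open>x\<close> over Z_p. Each element of the
  inverse class shifts a slice of size b into Z_p. On the other side the coefficient at 0 vanishes
  because \<open>Y\<close> misses the class of c, and the remaining ones are constant on orbits of
  size m.\<close>

lemma m_dvd_slice:
  assumes "finite Y" "Y \<subseteq> reps" "bsum Y \<in> int_schur" "Y \<inter> cl c = {}"
    and "\<And>h. rel c h \<Longrightarrow> slice_card Y (fst h) = b"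
    and "coprime (card (cl c)) m"
  shows "m dvd b"
proof -
  define x where "x = bsum (cl (- c)) * bsum Y"
  have xS: "x \<in> int_schur" unfolding x_def by (intro int_schur_mult int_schur_bsum_cl assms)
  have rv: "rel c (- v)" if "v \<in> cl (- c)" for v using rel_uminus[OF cl_rel[OF that]] by simp
  have "coef (zp_sum * x) 0 = coef (bsum (cl (- c)) * (bsum Y * zp_sum)) 0" by (simp add: x_def mult_ac)
  also have "\<dots> = (\<Sum>v\<in>cl (- c). coef (bsum Y * zp_sum) (0 - v))" by (rule coef_bsum_mult_left)
  also have "\<dots> = (\<Sum>v\<in>cl (- c). int b)"
  proof (rule sum.cong)
    fix v assume "v \<in> cl (- c)"
    then show "coef (bsum Y * zp_sum) (0 - v) = int b"
      using assms(5)[OF rv] assms(1) by (simp add: coef_bsum_zp_sum slice_card_def)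
  qed simp
  also have "\<dots> = int (card (cl c) * b)" by (simp add: card_cl_uminus)
  finally have 1: "coef (zp_sum * x) 0 = int (card (cl c) * b)" .
  have "coef x 0 = (\<Sum>v\<in>cl (- c). coef (bsum Y) (0 - v))" unfolding x_def by (rule coef_bsum_mult_left)
  also have "\<dots> = 0"
  proof (rule sum.neutral, intro ballI)
    fix v assume "v \<in> cl (- c)"
    then have "red (- v) \<in> cl c" using rv by simp
    then show "coef (bsum Y) (0 - v) = 0" using assms(1,2,4) by (auto simp: coef_bsum_reps)
  qed
  finally have 0: "coef x 0 = 0" .
  have "coef (zp_sum * x) 0 = (\<Sum>u\<in>{0} \<times> {0..<int p}. coef x (0 - u))"
    unfolding zp_sum_def by (rule coef_bsum_mult_left)
  also have "{0::int} \<times> {0..<int p} = insert 0 ({0} \<times> {1..<int p})" using p_gt1 by (auto simp: zero_prod_def)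
  also have "(\<Sum>u\<in>insert 0 ({0} \<times> {1..<int p}). coef x (0 - u)) = (\<Sum>u\<in>{0} \<times> {1..<int p}. coef x (0 - u))"
    using 0 by (subst sum.insert) (auto simp: zero_prod_def)
  finally have "coef (zp_sum * x) 0 = (\<Sum>u\<in>{0} \<times> {1..<int p}. coef x (- u))" by simp
  then have "int m dvd int (card (cl c) * b)"
    using sum_layer0(1)[of "\<lambda>u. coef x (- u)"] int_schur_D[OF xS rel_uminus] 1 by simp
  then have "m dvd card (cl c) * b" by presburger
  then show ?thesis using assms(6) by (metis coprime_commute coprime_dvd_mult_right_iff)
qed

text \<open>A slice \<open>A\<close> with \<open>0 < card A < p\<close> satisfies \<open>A ^ p \<equiv> card A (mod p)\<close> up to a power of \<open>z\<close>,
  so it is invertible modulo \<open>p\<close> and multiplication by it is injective on the Schur ring of \<open>Z_p\<close>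
  modulo \<open>p\<close>.\<close>

lemma slice_mult_inj:
  assumes "finite A" "\<And>u. u \<in> A \<Longrightarrow> fst u = i" "\<not> p dvd card A"
    and "\<And>g. fst g \<noteq> 0 \<Longrightarrow> coef d g = 0"
    and "\<And>g. fst g = i \<Longrightarrow> int p dvd coef (bsum A * d) g"
  shows "int p dvd coef d (0, t)"
proof -
  have all: "int p dvd coef (bsum A * d) g" for g
  proof (cases "fst g = i")
    case False
    then have "coef (bsum A * d) g = 0"
      unfolding coef_bsum_mult_left using assms(2,4) by (intro sum.neutral) auto
    then show ?thesis by simp
  qed (use assms(5) in blast)
  have "bsum A ^ p * d = bsum A ^ (p - 1) * (bsum A * d)"
    using p_nz by (metis mult.assoc power_minus_mult)
  then have 1: "int p dvd coef (bsum A ^ p * d) g" for g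
    using coef_mult_dvd[OF all] by simp
  obtain r where r: "bsum A ^ p = (\<Sum>u\<in>A. Poly_Mapping.single (scale (int p) u) 1) + of_nat p * r"
    using bsum_power_prime[OF prime_p assms(1)] by blast
  have "coef (bsum A ^ p * d) (int p * i, t)
      = (\<Sum>u\<in>A. coef d ((int p * i, t) - scale (int p) u)) + int p * coef (r * d) (int p * i, t)"
    by (simp add: r ring_distribs coef_add sum_distrib_right coef_sum coef_single_mult mult.assoc coef_of_nat_mult)
  also have "(\<Sum>u\<in>A. coef d ((int p * i, t) - scale (int p) u)) = (\<Sum>u\<in>A. coef d (0, t))"
    using assms(2) by (intro sum.cong coef_cong) (auto simp: red_eq_iff)
  finally have "int p dvd int (card A) * coef d (0, t)"
    using 1[of "(int p * i, t)"] by (simp add: dvd_add_left_iff)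
  moreover have "\<not> int p dvd int (card A)" using assms(3) by presburger
  moreover have "Factorial_Ring.prime (int p)" using prime_p by simp
  ultimately show ?thesis using prime_dvd_mult_iff by blast
qed

text \<open>A dimension count modulo p, phrased as a count of functions: multiplication by a slice
  over i maps T modulo p injectively to functions on the classes over i.\<close>

lemma card_classes_le:
  assumes "proper_layer i"
  shows "card (layer_classes 0) \<le> card (layer_classes i)"
proof -
  define Xc where "Xc = cl (i, 0)"
  define A where "A = {u\<in>Xc. fst u = i}"
  define y where "y f = (\<Sum>E\<in>layer_classes 0. Poly_Mapping.single 0 (f E) * bsum E)" for f :: "zz set \<Rightarrow> int"
  define r where "r C = (SOME g. fst g = i \<and> cl g = C)" for C
  \<comment> \<open>Coefficient vectors with entries from 0 to p - 1 stand for the elements of T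
    modulo p; \<open>\<Phi>\<close> lists the coefficients of their products with a class sum, one
    for each class over i.\<close>
  define F where "F = PiE (layer_classes 0) (\<lambda>_. {0..<int p})"
  define \<Phi> where "\<Phi> f = restrict (\<lambda>C. coef (bsum Xc * y f) (r C) mod int p) (layer_classes i)" for f
  have yS: "y f \<in> int_schur" for f
  proof (rule int_schur_I)
    fix g h assume gh: "rel g h"
    have "coef (bsum C) g = coef (bsum C) h" if "C \<in> layer_classes 0" for C
      using that int_schur_D[OF int_schur_bsum_cl gh] by (metis layer_classesE)
    then show "coef (y f) g = coef (y f) h" by (simp add: y_def coef_sum coef_single_mult)
  qed
  have coy: "coef (y f) g = (if fst g = 0 then f (cl g) else 0)" for f g
  proof -
    have "coef (y f) g = (\<Sum>C\<in>layer_classes 0. if C = cl g then f (cl g) else 0)"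
      unfolding y_def coef_sum
    proof (rule sum.cong)
      fix C assume "C \<in> layer_classes 0"
      then obtain h where h: "C = cl h" by (metis layer_classesE)
      have "red g \<in> C \<longleftrightarrow> C = cl g" using cl_cong[of h g] by (auto simp: h) (metis red_in_cl rel_refl)
      then show "coef (Poly_Mapping.single 0 (f C) * bsum C) g = (if C = cl g then f (cl g) else 0)"
        by (simp add: coef_single_mult coef_bsum_reps h cl_reps)
    qed simp
    moreover have "cl g \<in> layer_classes 0 \<longleftrightarrow> fst g = 0"
    proof
      assume "cl g \<in> layer_classes 0"
      then obtain h where "fst h = 0" "cl g = cl h" by (metis layer_classesE)
      then show "fst g = 0" using red_in_cl[of g g] red_in_cl[of g h] rel_fst0 rel_refl by metis
    qed (use cl_in_layer_classes[of g] in simp)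
    ultimately show ?thesis by simp
  qed
  have "inj_on \<Phi> F"
  proof (rule inj_onI)
    fix f f' assume ff: "f \<in> F" "f' \<in> F" "\<Phi> f = \<Phi> f'"
    define d where "d = y f - y f'"
    have d0: "coef d g = 0" if "fst g \<noteq> 0" for g using that by (simp add: d_def coef_diff coy)
    have Ad: "int p dvd coef (bsum A * d) g" if g: "fst g = i" for g
    proof -
      have "fst (r (cl g)) = i \<and> cl (r (cl g)) = cl g" unfolding r_def by (rule someI[of _ g]) (simp add: g)
      then have "rel g (r (cl g))" using red_in_cl[of "r (cl g)" g] red_in_cl[of "r (cl g)" "r (cl g)"] by simp
      then have eq: "coef (bsum Xc * y f) g = coef (bsum Xc * y f) (r (cl g))" for f
        using int_schur_D[OF int_schur_mult[OF int_schur_bsum_cl yS]] unfolding Xc_def by blast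
      have "coef (bsum Xc * y f) g mod int p = coef (bsum Xc * y f') g mod int p"
        using fun_cong[OF ff(3), of "cl g"] cl_in_layer_classes[of g] g by (simp add: \<Phi>_def eq)
      then have "int p dvd coef (bsum Xc * y f) g - coef (bsum Xc * y f') g" by (simp add: mod_eq_dvd_iff)
      also have "coef (bsum Xc * y f) g - coef (bsum Xc * y f') g = coef (bsum Xc * d) g"
        by (simp add: d_def right_diff_distrib coef_diff)
      also have "\<dots> = (\<Sum>u\<in>Xc. coef d (g - u))" by (rule coef_bsum_mult_left)
      \<comment> \<open>Since \<open>d\<close> lives over 0, only the slice of \<open>Xc\<close>
        over i contributes at an element over i.\<close>
      also have "\<dots> = (\<Sum>u\<in>A. coef d (g - u))"
      proof (rule sum.mono_neutral_right)
        show "\<forall>u\<in>Xc - A. coef d (g - u) = 0"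
        proof
          fix u assume "u \<in> Xc - A"
          then have "fst (g - u) \<noteq> 0" using g by (auto simp: A_def)
          then show "coef d (g - u) = 0" by (rule d0)
        qed
      qed (auto simp: A_def Xc_def)
      also have "\<dots> = coef (bsum A * d) g" by (rule coef_bsum_mult_left[symmetric])
      finally show ?thesis .
    qed
    have "card A = slice_card Xc i" by (simp add: A_def slice_card_def)
    then have nd: "\<not> p dvd card A"
      using slice_card_self[of "(i,0)"] proper_layer_slice_card[of "(i,0)"] assms by (auto simp: Xc_def dest: dvd_imp_le)
    have fA: "finite A" "\<And>u. u \<in> A \<Longrightarrow> fst u = i" by (simp_all add: A_def Xc_def)
    have dv: "int p dvd coef d (0, t)" for t
      by (rule slice_mult_inj[OF fA nd d0 Ad])
    show "f = f'"
    proof (rule PiE_ext[OF ff(1,2)[unfolded F_def]])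
      fix C assume C: "C \<in> layer_classes 0"
      then obtain g where g: "fst g = 0" "C = cl g" by (metis layer_classesE)
      have "(0, snd g) = g" using g(1) by (simp add: prod_eq_iff)
      then have "int p dvd coef d g" using dv[of "snd g"] by simp
      then have "int p dvd f C - f' C" using g by (simp add: d_def coef_diff coy)
      moreover have "f C \<in> {0..<int p}" "f' C \<in> {0..<int p}" using ff(1,2) C unfolding F_def by (auto dest: PiE_mem)
      ultimately show "f C = f' C" by (auto dest!: mod_eq_dvd_iff[THEN iffD2])
    qed
  qed
  moreover have "\<Phi> ` F \<subseteq> PiE (layer_classes i) (\<lambda>_. {0..<int p})"
    by (auto simp: \<Phi>_def)
  moreover have "finite (PiE (layer_classes i) (\<lambda>_. {0..<int p}))" by (intro finite_PiE) auto
  ultimately have "card F \<le> card (PiE (layer_classes i) (\<lambda>_. {0..<int p}))" by (metis card_inj_on_le)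
  then have "p ^ card (layer_classes 0) \<le> p ^ card (layer_classes i)" by (simp add: F_def card_PiE)
  then show ?thesis using prime_p prime_gt_1_nat by (metis power_le_imp_le_exp)
qed

lemma sum_slice_card_classes: "(\<Sum>C\<in>layer_classes i. slice_card C i) = p"
proof -
  define S where "S C = {u\<in>C. fst u = i}" for C :: "zz set"
  have "(\<Union>C\<in>layer_classes i. S C) = {i} \<times> {0..<int p}"
  proof (intro equalityI subsetI)
    fix u assume "u \<in> (\<Union>C\<in>layer_classes i. S C)"
    then obtain C where "C \<in> layer_classes i" "u \<in> C" "fst u = i" unfolding S_def by blast
    then obtain g where "u \<in> cl g" by (metis layer_classesE)
    then show "u \<in> {i} \<times> {0..<int p}" using slice_card_sub[of g i] \<open>fst u = i\<close> by blast
  next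
    fix u assume u: "u \<in> {i} \<times> {0..<int p}"
    then have "u \<in> reps" "fst u = i" by (auto simp: reps_def)
    then have "u \<in> S (cl u)" "cl u \<in> layer_classes i"
      using cl_iff[of u u] red_id[of u] cl_in_layer_classes[of u] by (simp_all add: S_def)
    then show "u \<in> (\<Union>C\<in>layer_classes i. S C)" by blast
  qed
  moreover have "card (\<Union>C\<in>layer_classes i. S C) = (\<Sum>C\<in>layer_classes i. card (S C))"
  proof (rule card_UN_disjoint)
    show "\<forall>C\<in>layer_classes i. finite (S C)" unfolding S_def layer_classes_def by simp
    show "\<forall>C\<in>layer_classes i. \<forall>C'\<in>layer_classes i. C \<noteq> C' \<longrightarrow> S C \<inter> S C' = {}"
    proof (intro ballI impI)
      fix C C' assume "C \<in> layer_classes i" "C' \<in> layer_classes i" "C \<noteq> C'"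
      then have "C \<in> D" "C' \<in> D" using cl_D by (metis layer_classesE)+
      then show "S C \<inter> S C' = {}" using D_disj \<open>C \<noteq> C'\<close> unfolding S_def by blast
    qed
  qed simp
  ultimately have "card ({i} \<times> {0..<int p}) = (\<Sum>C\<in>layer_classes i. card (S C))" by simp
  then show ?thesis by (simp add: S_def slice_card_def card_cartesian_product)
qed

text \<open>The classes other than that of x number at least (p - 1)/m and have at least m elements
  each over i, so they use up p - 1 of the p elements of the layer.\<close>

lemma singleton_slice:
  assumes "proper_layer i" "fst x = i" "\<And>y. fst y = i \<Longrightarrow> \<not> rel x y \<Longrightarrow> m dvd slice_card (cl y) i"
  shows "slice_card (cl x) i = 1"
proof -
  have Xc: "cl x \<in> layer_classes i" using cl_in_layer_classes assms(2) by blast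
  have ge: "m \<le> slice_card C i" if "C \<in> layer_classes i - {cl x}" for C
  proof -
    obtain y where y: "fst y = i" "C = cl y" using \<open>C \<in> layer_classes i - {cl x}\<close> by (metis DiffD1 layer_classesE)
    then have "\<not> rel x y" using that cl_cong by blast
    then have "m dvd slice_card (cl y) i" using assms(3) y by blast
    then show ?thesis using slice_card_self[of y] y by (auto dest: dvd_imp_le)
  qed
  have "p = slice_card (cl x) i + (\<Sum>C\<in>layer_classes i - {cl x}. slice_card C i)"
    using sum.remove[OF finite_layer_classes Xc, of "\<lambda>C. slice_card C i"] by (simp add: sum_slice_card_classes)
  moreover have "card (layer_classes i - {cl x}) = card (layer_classes i) - 1" using Xc by simp
  then have "(\<Sum>C\<in>layer_classes i - {cl x}. slice_card C i) \<ge> (card (layer_classes i) - 1) * m"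
    using sum_bounded_below[of "layer_classes i - {cl x}" m "\<lambda>C. slice_card C i"] ge by simp
  moreover have "(card (layer_classes i) - 1) * m \<ge> (card (layer_classes 0) - 1) * m"
    using card_classes_le[OF assms(1)] by (intro mult_le_mono1) simp
  moreover have "(card (layer_classes 0) - 1) * m = p - 1" using sum_layer0(2)[of "\<lambda>_. 0"] by simp
  moreover have "slice_card (cl x) i > 0" using slice_card_self[of x] assms(2) by simp
  moreover have "p > 1" using prime_p prime_gt_1_nat by blast
  ultimately have "slice_card (cl x) i \<le> 1 \<and> slice_card (cl x) i > 0" by linarith
  then show ?thesis by linarith
qed

lemma layer1_singleton:
  assumes "coprime (card (cl c)) m" "\<not> int p dvd fst c" "proper_layer 1"
  obtains x where "fst x = 1" "slice_card (cl x) 1 = 1"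
proof -
  define i where "i = fst c"
  have i: "i \<noteq> 0" "\<not> int p dvd i" using assms(2) by (auto simp: i_def)
  have "Factorial_Ring.prime (int p)" using prime_p by simp
  then have "coprime i (int p)" using i(2) by (metis coprime_commute prime_imp_coprime)
  then obtain a b where ab: "a * i + b * int p = 1" using bezout_int[of i "int p"] by auto
  \<comment> \<open>As \<open>a\<close> inverts i modulo p, the i-th power of x is c. The class of x
    is the exceptional one over 1.\<close>
  define x where "x = (1::int, a * snd c)"
  have "a * i * snd c + b * int p * snd c = snd c" using arg_cong[OF ab, of "\<lambda>t. t * snd c"] by (simp add: distrib_right)
  then have "i * (a * snd c) - snd c = int p * (- b * snd c)" by (simp add: algebra_simps)
  then have rx: "red (scale i x) = red c"
    by (simp add: red_eq_iff x_def i_def)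
  have "slice_card (cl x) 1 = 1"
  proof (rule singleton_slice[OF assms(3)])
    show "fst x = 1" by (simp add: x_def)
    fix y assume y: "fst y = 1" "\<not> rel x y"
    \<comment> \<open>The i-th powers of another class over 1. They form an S-set by
      \<open>mult_int\<close>, which misses the class of c because taking i-th powers is
      injective.\<close>
    define Y where "Y = (\<lambda>v. red (scale i v)) ` cl y"
    have inj: "inj_on (\<lambda>v. red (scale i v)) (cl y)"
    proof (rule inj_onI)
      fix u v assume "u \<in> cl y" "v \<in> cl y" "red (scale i u) = red (scale i v)"
      then show "u = v" using red_scale_inj[OF _ i] cl_red by metis
    qed
    have szY: "slice_card Y (i * l) = slice_card (cl y) l" for l
    proof -
      have "{u\<in>Y. fst u = i * l} = (\<lambda>v. red (scale i v)) ` {v\<in>cl y. fst v = l}"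
        using i(1) by (auto simp: Y_def)
      then show ?thesis using inj unfolding slice_card_def by (metis (no_types, lifting) card_image inj_on_subset mem_Collect_eq subsetI)
    qed
    show "m dvd slice_card (cl y) 1"
    proof (rule m_dvd_slice[OF _ _ _ _ _ assms(1), of Y])
      show "finite Y" "Y \<subseteq> reps" by (auto simp: Y_def)
      then show "bsum Y \<in> int_schur"
      proof (rule int_schur_bsum)
        fix g h assume gh: "rel g h" "red g \<in> Y"
        then obtain v where v: "v \<in> cl y" "red g = red (scale i v)" unfolding Y_def by blast
        then have "rel (scale i v) h" using gh(1) rel_cong[of g "scale i v" h h] by simp
        from mult_int[OF i this] obtain v' where v': "rel v v'" "red (scale i v') = red h" by blast
        have "red v' \<in> cl y" using rel_trans[OF cl_rel[OF v(1)] v'(1)] by simp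
        moreover have "red h = red (scale i (red v'))" using v'(2) red_scale_cong[of "red v'" v' i] by simp
        ultimately show "red h \<in> Y" unfolding Y_def by blast
      qed
      show "Y \<inter> cl c = {}"
      proof (rule ccontr)
        assume "Y \<inter> cl c \<noteq> {}"
        then obtain v where v: "v \<in> cl y" "red (scale i v) \<in> cl c" unfolding Y_def by blast
        then have "rel (scale i x) (scale i v)" using rel_cong[OF rx refl] by simp
        from mult_int[OF i this] obtain w where w: "rel x w" "red (scale i w) = red (scale i v)" by blast
        then have "red w = red v" using red_scale_inj[OF _ i] by blast
        then have "rel x v" using w(1) rel_cong[of x x w v] by simp
        then show False using y(2) rel_trans[OF _ rel_sym[OF cl_rel[OF v(1)]]] by blast
      qed
      fix h assume h: "rel c h"
      show "slice_card Y (fst h) = slice_card (cl y) 1"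
      \<comment> \<open>If the class of c also meets layer -i, then 1 and -1 are linked, and the
        slices of the class of y over them have the same size.\<close>
      proof (cases "fst h = i")
        case True
        then show ?thesis using szY[of 1] by simp
      next
        case False
        then have hi: "fst h = - i" using rel_pm[OF h] by (simp add: i_def)
        then have "layer_rel (i * 1) (- i)" using LrI[OF h] by (simp add: i_def)
        from qmult[OF i(1) this] obtain l where l: "layer_rel 1 l" "- i = i * l" by blast
        have "i * (l + 1) = 0" using l(2) by (simp add: distrib_left)
        then have "l = -1" using i(1) by simp
        then show ?thesis using szY[of "-1"] slice_card_layer_rel[OF l(1), of y] hi by simp
      qed
    qed
  qed
  then show thesis using that[of x] by (simp add: x_def)
qed

section \<open>Classes determined by a one-element slice\<close>

lemma rel_single_int_schur:
  assumes "\<And>h. rel v h \<Longrightarrow> red h = red v"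
  shows "Poly_Mapping.single v 1 \<in> int_schur"
proof (rule int_schur_I)
  fix g h assume gh: "rel g h"
  have "red v = red g \<longleftrightarrow> red v = red h"
  proof
    assume vg: "red v = red g"
    have "rel v h" using rel_cong[OF vg refl, of h] gh by blast
    from assms[OF this] show "red v = red h" by (rule sym)
  next
    assume vh: "red v = red h"
    have "rel v g" using rel_cong[OF vh refl, of g] rel_sym[OF gh] by blast
    from assms[OF this] show "red v = red g" by (rule sym)
  qed
  then show "coef (Poly_Mapping.single v 1) g = coef (Poly_Mapping.single v 1) h" by (simp add: coef_single)
qed

text \<open>The shift of a class sum by v lies in the Schur ring again, so a translate of a class is
  a union of classes.\<close>

lemma rel_translate:
  assumes "Poly_Mapping.single v 1 \<in> int_schur" "rel g h"
  shows "rel (g - v) (h - v)"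
proof -
  have "Poly_Mapping.single v 1 * bsum (cl (g - v)) \<in> int_schur" by (intro int_schur_mult assms int_schur_bsum_cl)
  from int_schur_D[OF this assms(2)] show ?thesis by (simp add: coef_single_mult coef_bsum_reps cl_reps split: if_splits)
qed

lemma slice_card_1E:
  assumes "slice_card (cl x) i = 1" "rel x u" "fst u = i" "rel x v" "fst v = i"
  shows "red u = red v"
proof -
  have "red u \<in> {u\<in>cl x. fst u = i}" "red v \<in> {u\<in>cl x. fst u = i}" using assms by simp_all
  then show ?thesis using assms(1) unfolding slice_card_def by (metis (no_types, lifting) card_1_singletonE singletonD)
qed

text \<open>Here x is a class by itself, and so all its powers lie in the Schur ring. Translating by
  the power over the layer of g moves g into Z_p, where the classes are the orbits of
  \<open>W\<close>.\<close>

lemma rel_one_sided: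
  assumes x: "fst x = 1" "slice_card (cl x) 1 = 1" and no: "\<not> layer_rel 1 (-1)"
  shows "rel g h \<longleftrightarrow> (\<exists>w\<in>W. red h = red (scale (fst g) x + (0, w * snd (g - scale (fst g) x))))"
proof -
  have 1: "red h = red x" if "rel x h" for h
  proof -
    have "fst h = 1" using rel_pm[OF that] LrI[OF that] no x(1) by auto
    then show ?thesis using slice_card_1E[OF x(2) that _ rel_refl] x(1) by simp
  qed
  have S1: "Poly_Mapping.single x 1 \<in> int_schur" using 1 by (rule rel_single_int_schur)
  have 2: "red h = red (- x)" if "rel (- x) h" for h
    using red_uminus_cong[OF 1[of "- h"]] rel_uminus[OF that] by simp
  have S2: "Poly_Mapping.single (- x) 1 \<in> int_schur" using 2 by (rule rel_single_int_schur)
  have S: "Poly_Mapping.single (scale k x) 1 \<in> int_schur" for k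
  proof (cases "k \<ge> 0")
    case True
    then show ?thesis using int_schur_power[OF S1, of "nat k"] by (simp add: single_power)
  next
    case False
    have "scale (- k) (- x) = scale k x" by (simp add: scale_def)
    then show ?thesis using int_schur_power[OF S2, of "nat (- k)"] False by (simp add: single_power)
  qed
  define v where "v = scale (fst g) x"
  define t where "t = snd (g - v)"
  have gv: "g - v = (0, t)" using x(1) by (simp add: v_def t_def prod_eq_iff)
  have "rel g h \<longleftrightarrow> rel (0, t) (h - v)"
  proof
    assume "rel g h"
    then show "rel (0, t) (h - v)" using rel_translate[OF S] gv unfolding v_def by metis
  next
    have m: "scale (- fst g) x = - v" by (simp add: v_def scale_def)
    assume "rel (0, t) (h - v)"
    then have "rel (g - v) (h - v)" by (simp add: gv)
    then have "rel (g - v - - v) (h - v - - v)" using rel_translate[OF S[of "- fst g"]] unfolding m by blast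
    then show "rel g h" by simp
  qed
  moreover have "(red (h - v) = red (0, w * t)) = (red h = red (v + (0, w * t)))" for w
    using red_add_cong[of "h - v" "(0, w * t)" v v] red_diff_cong[of h "v + (0, w * t)" v v]
    by (auto simp: add.commute)
  ultimately have "rel g h \<longleftrightarrow> (\<exists>w\<in>W. red h = red (v + (0, w * t)))"
    by (simp add: rel_layer0)
  then show ?thesis by (simp only: v_def t_def)
qed

lemma odd_m:
  assumes "coprime (card (cl c)) m" "fst c \<noteq> 0" "layer_rel 1 (-1)"
  shows "odd m"
proof -
  have "cl c = {u\<in>cl c. fst u = fst c} \<union> {u\<in>cl c. fst u = - fst c}"
    using rel_pm[OF cl_rel] by blast
  moreover have "{u\<in>cl c. fst u = fst c} \<inter> {u\<in>cl c. fst u = - fst c} = {}" using assms(2) by auto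
  ultimately have "card (cl c) = slice_card (cl c) (fst c) + slice_card (cl c) (- fst c)"
    unfolding slice_card_def by (subst card_Un_disjoint[symmetric]) simp_all
  also have "slice_card (cl c) (- fst c) = slice_card (cl c) (fst c)" using slice_card_layer_rel[OF layer_rel_uniform[OF assms(3)]] by simp
  finally have "even (card (cl c))" by simp
  then show ?thesis using assms(1) by (meson coprime_common_divisor odd_one)
qed

text \<open>Now x shares its class with an element v = x^(-1) a^c, and translation by x is no longer
  available. The power sums x^k + v^k replace the powers of x: they confine a class over k to two
  translates of an orbit, and parity shows that it fills both.\<close>

lemma rel_two_sided:
  assumes x: "fst x = 1" "slice_card (cl x) 1 = 1" and two: "layer_rel 1 (-1)" and m: "odd m"
  obtains c where "\<And>g h. rel g h \<longleftrightarrow> (\<exists>w\<in>W.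
      red h = red (scale (fst g) x + (0, w * snd (g - scale (fst g) x))) \<or>
      red h = red (scale (- fst g) x + (0, fst g * c + w * snd (g - scale (fst g) x))))"
proof -
  have "layer_rel (fst x) (-1)" using two x(1) by simp
  then obtain v where v: "rel x v" "fst v = -1" using layer_rel_lift by blast
  define c where "c = snd v + snd x"
  have vc: "v = - x + (0, c)" using v x(1) by (simp add: c_def prod_eq_iff)
  \<comment> \<open>The power sum x^k + v^k, written with v = x^(-1) a^c.\<close>
  define P where "P k = Poly_Mapping.single (scale k x) (1::int) + Poly_Mapping.single (scale (- k) x + (0, k * c)) 1" for k
  have coefP: "coef (P k * y) g = coef y (g - scale k x) + coef y (g - (scale (- k) x + (0, k * c)))" for k y g
    by (simp add: P_def distrib_right coef_add coef_single_mult)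
  have relx: "rel x h \<longleftrightarrow> red h = red x \<or> red h = red v" for h
  proof
    assume h: "rel x h"
    from rel_pm[OF h] show "red h = red x \<or> red h = red v"
    proof
      assume "fst h = fst x"
      then show ?thesis using slice_card_1E[OF x(2) h _ rel_refl] x(1) by simp
    next
      assume "fst h = - fst x"
      moreover have "slice_card (cl x) (-1) = 1" using slice_card_layer_rel[OF two] x(2) by simp
      ultimately show ?thesis using slice_card_1E[OF _ h _ v(1)] v(2) x(1) by simp
    qed
  next
    assume "red h = red x \<or> red h = red v"
    then show "rel x h" using rel_cong[of x x h x] rel_cong[of x x h v] v(1) by auto
  qed
  have P1: "P 1 \<in> int_schur"
  proof (rule int_schur_cong[OF int_schur_bsum_cl[of x]])
    fix g
    have "scale 1 x = x" "scale (-1) x + (0, 1 * c) = v" by (simp_all add: vc scale_def prod_eq_iff)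
    then have "coef (P 1) g = (if red x = red g then 1 else 0) + (if red v = red g then 1 else 0)"
      by (simp add: P_def coef_add coef_single)
    moreover have "red x \<noteq> red v" using x(1) v(2) by (simp add: red_eq_iff)
    moreover have "coef (bsum (cl x)) g = (if rel x g then 1 else 0)" by (simp add: coef_bsum_reps cl_reps)
    ultimately show "coef (bsum (cl x)) g = coef (P 1) g" by (auto simp: relx)
  qed
  have P0: "P 0 \<in> int_schur"
  proof -
    have "P 0 = 1 + 1" by (simp add: P_def scale_def flip: zero_prod_def)
    then show ?thesis using int_schur_add[OF int_schur_1 int_schur_1] by simp
  qed
  \<comment> \<open>The square of x + v is x^2 + v^2 + 2 x v, and only the last term, 2 a^c, lies
    over 0. Hence a^c is a class by itself.\<close>
  have fixc: "red h = red (0, c)" if "rel (0, c) h" for h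
  proof (rule ccontr)
    assume no: "red h \<noteq> red (0, c)"
    have h0: "fst h = 0" using rel_fst0[OF that] by simp
    have co: "coef (P 1 * P 1) g = (if red g = red (0, c) then 2 else 0)" if "fst g = 0" for g
    proof -
      have 1: "coef (P 1) u = (if red x = red u then 1 else 0) + (if red v = red u then 1 else 0)" for u
      proof -
        have "scale 1 x = x" "scale (-1) x + (0, 1 * c) = v" by (simp_all add: vc scale_def prod_eq_iff)
        then show ?thesis by (simp add: P_def coef_add coef_single)
      qed
      have e: "scale 1 x = x" "scale (-1) x + (0, 1 * c) = v" by (simp_all add: vc scale_def prod_eq_iff)
      have "red x \<noteq> red (g - x)" "red v \<noteq> red (g - v)" using that x(1) v(2) by (simp_all add: red_eq_iff)
      moreover have "red v = red (g - x) \<longleftrightarrow> red g = red (0, c)" "red x = red (g - v) \<longleftrightarrow> red g = red (0, c)"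
        using that x(1) v(2) by (auto simp: red_eq_iff c_def algebra_simps dvd_diff_commute)
      ultimately show ?thesis unfolding coefP e 1 by simp
    qed
    have "coef (P 1 * P 1) (0, c) = coef (P 1 * P 1) h" by (rule int_schur_D[OF int_schur_mult[OF P1 P1] that])
    then show False using co[of "(0, c)"] co[of h] h0 no by simp
  qed
  have wc: "int p dvd w * c - c" if "w \<in> W" for w
  proof -
    have "rel (0, c) (0, w * c)" using that rel_layer0 by blast
    from fixc[OF this] show ?thesis by (simp add: red_eq_iff)
  qed
  have fixkc: "Poly_Mapping.single (0, k * c) 1 \<in> int_schur" for k
  proof (rule rel_single_int_schur)
    fix h assume "rel (0, k * c) h"
    then obtain w where w: "w \<in> W" "red h = red (0, w * (k * c))" using rel_layer0 by blast
    have "int p dvd k * (w * c - c)" using wc[OF w(1)] by simp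
    then have "red (0, w * (k * c)) = red (0, k * c)" by (simp add: red_eq_iff algebra_simps)
    then show "red h = red (0, k * c)" using w by simp
  qed
  have Pn: "P (int n) \<in> int_schur \<and> P (int (Suc n)) \<in> int_schur" for n
  proof (induction n)
    case 0
    then show ?case using P0 P1 by simp
  next
    case (Suc n)
    \<comment> \<open>Newton recurrence in two variables, with elementary symmetric functions x + v
      and x v = a^c.\<close>
    have "P (int (Suc (Suc n))) = P 1 * P (int (Suc n)) - Poly_Mapping.single (0, 1 * c) 1 * P (int n)"
    proof -
      obtain a b where "x = (a, b)" by (cases x)
      then show ?thesis
        by (simp add: P_def mult_single scale_def algebra_simps)
          (rule arg_cong2[where f = Poly_Mapping.single]; simp)
    qed
    then show ?case using Suc by (simp add: int_schur_diff int_schur_mult P1 fixkc[of 1, simplified] del: of_nat_Suc)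
  qed
  have pos: "rel g h \<longleftrightarrow> (\<exists>w\<in>W. red h = red (scale k x + (0, w * t)) \<or> red h = red (scale (- k) x + (0, k * c + w * t)))"
    if k: "k > 0" and g: "g = scale k x + (0, t)" for g h k t
  proof -
    have PS: "P k \<in> int_schur" using Pn[of "nat k"] k by simp
    define O1 where "O1 = cl (0, t)"
    have O1: "u \<in> O1 \<Longrightarrow> fst u = 0" for u using rel_fst0[OF cl_rel[of u "(0, t)"]] by (simp add: O1_def)
    have cO: "coef (bsum O1) u = (if rel (0, t) u then 1 else 0)" for u
      by (simp add: O1_def coef_bsum_reps cl_reps)
    define s where "s = scale k x"
    define s' where "s' = scale (- k) x + (0, k * c)"
    have fs: "fst s = k" "fst s' = - k" using x(1) by (simp_all add: s_def s'_def)
    \<comment> \<open>The product of \<open>P k\<close> with the orbit sum is supported on the two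
      translates of the orbit and is nonzero at g, hence on the whole class of g.\<close>
    have sub: "rel (0, t) (h - s) \<or> rel (0, t) (h - s')" if h: "rel g h" for h
    proof -
      have "coef (P k * bsum O1) g = coef (P k * bsum O1) h"
        using int_schur_D[OF int_schur_mult[OF PS int_schur_bsum_cl] h] unfolding O1_def .
      moreover have "coef (bsum O1) (g - s) = 1" by (simp add: g s_def cO)
      ultimately show ?thesis unfolding coefP s_def[symmetric] s'_def[symmetric] by (auto simp: cO split: if_splits)
    qed
    define f where "f u = coef (bsum (cl g)) (u + s) + coef (bsum (cl g)) (u + s')" for u
    have cg: "coef (bsum (cl g)) u = (if rel g u then 1 else 0)" for u
      by (simp add: coef_bsum_reps cl_reps)
    have fconst: "f u = f (0, t)" if u: "rel (0, t) u" for u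
    proof -
      \<comment> \<open>The factor a^(-kc) turns x^k + v^k into v^(-k) + x^(-k), so the coefficient
        at u reads the class of g at u + s' and u + s. This exhibits \<open>f\<close> as the
        coefficients of a member of the Schur ring.\<close>
      let ?y = "Poly_Mapping.single (0, (- k) * c) 1 * (P k * bsum (cl g))"
      have "?y \<in> int_schur" by (intro int_schur_mult fixkc PS int_schur_bsum_cl)
      moreover have "coef ?y u = f u" for u
      proof -
        have "coef ?y u = coef (bsum (cl g)) (u - (0, (- k) * c) - s) + coef (bsum (cl g)) (u - (0, (- k) * c) - s')"
          by (simp only: coef_single_mult coefP s_def s'_def mult_1)
        moreover have "u - (0, (- k) * c) - s' = u + s" "u - (0, (- k) * c) - s = u + s'"
          by (simp_all add: s_def s'_def scale_def prod_eq_iff)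
        ultimately show ?thesis by (simp only: f_def add.commute)
      qed
      ultimately show ?thesis using int_schur_D[of ?y "(0, t)" u] u by simp
    qed
    have both: "rel g (u + s) \<and> rel g (u + s')" if u: "rel (0, t) u" for u
    proof (rule ccontr)
      \<comment> \<open>Then every element of the orbit has exactly one of its two translates in the
        class of g. The slices over k and -k being equally large, the orbit would have even size,
        but its size is 1 or m.\<close>
      assume no: "\<not> ?thesis"
      have "(0, t) + s = g" by (simp add: g s_def add.commute)
      then have "f (0, t) \<ge> 1" by (simp add: f_def cg)
      moreover have "f u \<le> 1" using no by (auto simp: f_def cg)
      ultimately have f1: "f (0, t) = 1" using fconst[OF u] by simp
      \<comment> \<open>Translation by r identifies the part of the orbit that is moved into the
        class with the slice of the class over the layer of r.\<close>
      have cnt: "(\<Sum>u\<in>O1. coef (bsum (cl g)) (u + r)) = int (slice_card (cl g) l)"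
        if r: "r = s \<or> r = s'" "l = fst r" for r l
      proof -
        have "(\<Sum>u\<in>O1. coef (bsum (cl g)) (u + r)) = int (card {u\<in>O1. rel g (u + r)})"
          unfolding cg O1_def by (simp add: sum.If_cases Int_def)
        also have "bij_betw (\<lambda>u. red (u + r)) {u\<in>O1. rel g (u + r)} {u\<in>cl g. fst u = l}"
        proof (rule bij_betw_byWitness[where f' = "\<lambda>u. red (u - r)"])
          show "\<forall>u\<in>{u\<in>O1. rel g (u + r)}. red (red (u + r) - r) = u"
          proof
            fix u assume "u \<in> {u\<in>O1. rel g (u + r)}"
            then have "red u = u" using cl_red[of u "(0, t)"] by (simp add: O1_def)
            then show "red (red (u + r) - r) = u" using red_diff_cong[of "red (u + r)" "u + r" r r] by simp
          qed
          show "\<forall>u\<in>{u\<in>cl g. fst u = l}. red (red (u - r) + r) = u"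
          proof
            fix u assume "u \<in> {u\<in>cl g. fst u = l}"
            then have "red u = u" using cl_red[of u g] by simp
            then show "red (red (u - r) + r) = u" using red_add_cong[of "red (u - r)" "u - r" r r] by simp
          qed
          show "(\<lambda>u. red (u + r)) ` {u\<in>O1. rel g (u + r)} \<subseteq> {u\<in>cl g. fst u = l}"
          proof (rule image_subsetI)
            fix u assume "u \<in> {u\<in>O1. rel g (u + r)}"
            then show "red (u + r) \<in> {u\<in>cl g. fst u = l}" using O1[of u] r(2) by simp
          qed
          show "(\<lambda>u. red (u - r)) ` {u\<in>cl g. fst u = l} \<subseteq> {u\<in>O1. rel g (u + r)}"
          proof (rule image_subsetI)
            fix u assume u: "u \<in> {u\<in>cl g. fst u = l}"
            have "rel (0, t) (u - r)"
            proof (cases "r = s")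
              case True
              then have "\<not> rel (0, t) (u - s')" using u r(2) fs k rel_fst0[of "(0,t)" "u - s'"] by auto
              then show ?thesis using sub[OF cl_rel[of u g]] u True by auto
            next
              case False
              then have "\<not> rel (0, t) (u - s)" using u r fs k rel_fst0[of "(0,t)" "u - s"] by auto
              then show ?thesis using sub[OF cl_rel[of u g]] u r(1) False by auto
            qed
            moreover have "rel g (red (u - r) + r)"
              using u cl_rel[of u g] rel_cong[of g g "red (u - r) + r" u] red_add_cong[of "red (u - r)" "u - r" r r] by simp
            ultimately show "red (u - r) \<in> {u\<in>O1. rel g (u + r)}" by (simp add: O1_def)
          qed
        qed
        then have "card {u\<in>O1. rel g (u + r)} = slice_card (cl g) l" unfolding slice_card_def by (rule bij_betw_same_card)
        finally show ?thesis .
      qed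
      have "int (card O1) = (\<Sum>u\<in>O1. f u)"
        using fconst f1 cl_rel by (simp add: O1_def)
      also have "\<dots> = int (slice_card (cl g) k) + int (slice_card (cl g) (- k))"
        using cnt[of s] cnt[of s'] fs by (simp add: f_def sum.distrib)
      also have "slice_card (cl g) (- k) = slice_card (cl g) k" using slice_card_layer_rel[OF layer_rel_uniform[OF two]] by simp
      finally have ev: "even (card O1)" by presburger
      have "odd (card O1)"
      proof (cases "t mod int p = 0")
        case True
        then have "O1 = {0}" unfolding O1_def using cl_cong[of "(0, t)" 0] rel_cong[of "(0,t)" 0 0 0] cl_0
          by (simp add: red_def zero_prod_def)
        then show ?thesis by simp
      next
        case False
        then have "t mod int p \<in> {1..<int p}" using pos_mod_bound[OF p_pos, of t] pos_mod_sign[OF p_pos, of t] by auto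
        moreover have "O1 = cl (0, t mod int p)" unfolding O1_def by (intro cl_cong) (simp add: rel_def red_def, metis rel_def rel_refl red_def fst_conv snd_conv)
        ultimately show ?thesis using card_orbit m by simp
      qed
      with ev show False by simp
    qed
    show ?thesis
    proof
      assume "rel g h"
      from sub[OF this] show "\<exists>w\<in>W. red h = red (scale k x + (0, w * t)) \<or> red h = red (scale (- k) x + (0, k * c + w * t))"
      proof
        assume "rel (0, t) (h - s)"
        then obtain w where w: "w \<in> W" "red (h - s) = red (0, w * t)" using rel_layer0 by blast
        have "red h = red (scale k x + (0, w * t))" using red_add_cong[OF w(2) refl, of s] by (simp add: s_def add.commute)
        then show ?thesis using w(1) by blast
      next
        assume "rel (0, t) (h - s')"
        then obtain w where w: "w \<in> W" "red (h - s') = red (0, w * t)" using rel_layer0 by blast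
        have "(0, w * t) + s' = scale (- k) x + (0, k * c + w * t)" by (simp add: s'_def prod_eq_iff)
        then have "red h = red (scale (- k) x + (0, k * c + w * t))" using red_add_cong[OF w(2) refl, of s'] by simp
        then show ?thesis using w(1) by blast
      qed
    next
      assume "\<exists>w\<in>W. red h = red (scale k x + (0, w * t)) \<or> red h = red (scale (- k) x + (0, k * c + w * t))"
      then obtain w where w: "w \<in> W" "red h = red ((0, w * t) + s) \<or> red h = red ((0, w * t) + s')"
        by (auto simp: s_def s'_def add_ac)
      then have "rel (0, t) (0, w * t)" using rel_layer0 by blast
      from both[OF this] w(2) show "rel g h"
        using rel_cong[of g g h "(0, w * t) + s"] rel_cong[of g g h "(0, w * t) + s'"] by auto
    qed
  qed
  show thesis
  proof (rule that[of c])
    fix g h :: zz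
    define k where "k = fst g"
    define t where "t = snd (g - scale k x)"
    have g: "g = scale k x + (0, t)" using x(1) by (simp add: prod_eq_iff k_def t_def)
    consider "k > 0" | "k = 0" | "k < 0" by linarith
    then have "rel g h \<longleftrightarrow> (\<exists>w\<in>W. red h = red (scale k x + (0, w * t)) \<or> red h = red (scale (- k) x + (0, k * c + w * t)))"
    proof cases
      case 1
      then show ?thesis using pos g by blast
    next
      case 2
      have "scale 0 x = (0, 0)" by (simp add: scale_def)
      then show ?thesis using 2 g rel_layer0[of t h] by simp
    next
      case 3
      \<comment> \<open>Negative layers follow from positive ones by inversion.\<close>
      have "- g = scale (- k) x + (0, - t)" by (simp add: g scale_def prod_eq_iff)
      then have A: "rel (- g) (- h) \<longleftrightarrow> (\<exists>w\<in>W. red (- h) = red (scale (- k) x + (0, w * - t))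
          \<or> red (- h) = red (scale (- (- k)) x + (0, - k * c + w * - t)))"
        using pos[of "- k" "- g" "- t" "- h"] 3 by simp
      have B: "rel (- g) (- h) \<longleftrightarrow> rel g h" using rel_uminus[of g h] rel_uminus[of "- g" "- h"] by auto
      have mm: "red (- h) = red u \<longleftrightarrow> red h = red (- u)" for u
        using red_uminus_cong[of "- h" u] red_uminus_cong[of h "- u"] by auto
      have e: "- (scale (- k) x + (0, w * - t)) = scale k x + (0, w * t)"
        "- (scale (- (- k)) x + (0, - k * c + w * - t)) = scale (- k) x + (0, k * c + w * t)" for w
        by (simp_all add: scale_def prod_eq_iff)
      show ?thesis using A unfolding mm e B .
    qed
    then show "rel g h \<longleftrightarrow> (\<exists>w\<in>W.
      red h = red (scale (fst g) x + (0, w * snd (g - scale (fst g) x))) \<or>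
      red h = red (scale (- fst g) x + (0, fst g * c + w * snd (g - scale (fst g) x))))"
      by (simp only: k_def t_def)
  qed
qed

section \<open>The stabiliser of the classes and the automorphic case\<close>

lemma bar_rel: "e \<in> D \<Longrightarrow> g \<in> reps \<Longrightarrow> h \<in> reps \<Longrightarrow> rel g h \<Longrightarrow> (bar e g :: 'f::field_char_0) = bar e h"
proof -
  assume *: "e \<in> D" "g \<in> reps" "h \<in> reps" "rel g h"
  have "g \<in> e \<longleftrightarrow> h \<in> e"
    using D_cl[OF *(1)] red_id[OF *(2)] red_id[OF *(3)] cl_cong[OF *(4)] rel_sym[OF *(4)] *(4)
    by (metis cl_iff)
  then show ?thesis by (simp add: bar_def)
qed

text \<open>Brings the span over F into the form in which it is compared with
  \<open>fixed_alg\<close>.\<close>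

lemma span_classes_eq:
  "(span_classes D :: (zz \<Rightarrow> 'f::field_char_0) set) =
    {x. finite (gsupp x) \<and> gsupp x \<subseteq> reps \<and> (\<forall>g\<in>reps. \<forall>h\<in>reps. rel g h \<longrightarrow> x g = x h)}"
proof (intro equalityI subsetI)
  fix x :: "zz \<Rightarrow> 'f" assume "x \<in> span_classes D"
  then obtain E c where E: "finite E" "E \<subseteq> D" "x = (\<lambda>g. \<Sum>e\<in>E. c e * bar e g)"
    unfolding span_classes_def by blast
  have sub: "gsupp x \<subseteq> \<Union>E"
  proof
    fix g assume "g \<in> gsupp x"
    then have "(\<Sum>e\<in>E. c e * bar e g) \<noteq> 0" by (simp add: gsupp_def E(3))
    then obtain e where "e \<in> E" "c e * bar e g \<noteq> 0" by (meson sum.neutral)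
    then show "g \<in> \<Union>E" by (auto simp: bar_def split: if_splits)
  qed
  moreover have "finite (\<Union>E)" using E(1,2) D_finite by blast
  moreover have "\<Union>E \<subseteq> reps" using E(2) D_reps by blast
  moreover have "x g = x h" if gh: "g \<in> reps" "h \<in> reps" "rel g h" for g h
    unfolding E(3)
  proof (rule sum.cong)
    fix e assume "e \<in> E"
    then have "e \<in> D" using E(2) by blast
    then show "c e * bar e g = c e * bar e h" using bar_rel[OF _ gh, of e, where 'f='f] by simp
  qed simp
  ultimately show "x \<in> {x. finite (gsupp x) \<and> gsupp x \<subseteq> reps \<and> (\<forall>g\<in>reps. \<forall>h\<in>reps. rel g h \<longrightarrow> x g = x h)}"
    using finite_subset by blast
next
  fix x :: "zz \<Rightarrow> 'f"
  assume "x \<in> {x. finite (gsupp x) \<and> gsupp x \<subseteq> reps \<and> (\<forall>g\<in>reps. \<forall>h\<in>reps. rel g h \<longrightarrow> x g = x h)}"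
  then have x: "finite (gsupp x)" "gsupp x \<subseteq> reps" "\<And>g h. g \<in> reps \<Longrightarrow> h \<in> reps \<Longrightarrow> rel g h \<Longrightarrow> x g = x h"
    by blast+
  define E where "E = cl ` gsupp x"
  \<comment> \<open>\<open>x\<close> has one value on the whole class, so any choice of element
    gives the coefficient.\<close>
  define c where "c e = x (SOME u. u \<in> e)" for e
  have cc: "c (cl g) = x g" if "g \<in> reps" for g
  proof -
    have "red g \<in> cl g" by simp
    then have "(SOME u. u \<in> cl g) \<in> cl g" by (rule someI)
    then show ?thesis unfolding c_def using x(3) that cl_rel cl_reps by (metis subsetD)
  qed
  have "x g = (\<Sum>e\<in>E. c e * bar e g)" for g
  proof (cases "g \<in> reps")
    case True
    have gcl: "g \<in> e \<longleftrightarrow> e = cl g" if "e \<in> E" for e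
    proof -
      have "e \<in> D" using that cl_D unfolding E_def by blast
      moreover have "g \<in> cl g" using True red_id by (simp add: cl_iff)
      ultimately show ?thesis using D_cl by blast
    qed
    have "(\<Sum>e\<in>E. c e * bar e g) = (\<Sum>e\<in>E. if e = cl g then x g else 0)"
      using gcl cc[OF True] by (intro sum.cong) (auto simp: bar_def)
    also have "\<dots> = x g"
    proof (cases "cl g \<in> E")
      case False
      then have "x g = 0" using True unfolding E_def gsupp_def by blast
      then show ?thesis by (intro trans[OF sum.neutral]) simp_all
    qed (use x(1) in \<open>simp add: E_def\<close>)
    finally show ?thesis by simp
  next
    case False
    then have "x g = 0" using x(2) unfolding gsupp_def by blast
    moreover have "bar e g = (0::'f)" if "e \<in> E" for e
      using that False cl_reps unfolding E_def bar_def by auto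
    ultimately show ?thesis by simp
  qed
  moreover have "finite E" "E \<subseteq> D" using x(1) cl_D by (auto simp: E_def)
  ultimately show "x \<in> span_classes D" unfolding span_classes_def by blast
qed

text \<open>The largest candidate for the group in \<open>automorphic\<close>. Taking every
  class-preserving automorphism makes the subgroup property formal and leaves only transitivity on
  each class.\<close>

definition stab :: "(zz \<Rightarrow> zz) set" where
  "stab = {\<sigma> \<in> auto (ZxZp p). \<forall>g\<in>reps. rel g (\<sigma> g)}"

lemma stab_reps: "\<sigma> \<in> stab \<Longrightarrow> g \<in> reps \<Longrightarrow> \<sigma> g \<in> reps"
  unfolding stab_def auto_def by (auto simp: hom_def)

lemma stab_hom: "\<sigma> \<in> stab \<Longrightarrow> g \<in> reps \<Longrightarrow> h \<in> reps \<Longrightarrow> \<sigma> (red (g + h)) = red (\<sigma> g + \<sigma> h)"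
  unfolding stab_def auto_def by (auto simp: hom_def)

lemma stab_mult:
  assumes "\<sigma> \<in> auto (ZxZp p)" "\<tau> \<in> auto (ZxZp p)" "g \<in> reps"
  shows "(\<sigma> \<otimes>\<^bsub>AutoGroup (ZxZp p)\<^esub> \<tau>) g = \<sigma> (\<tau> g)"
  using assms by (simp add: AutoGroup_def BijGroup_def auto_def compose_def)

lemma stab_subgroup: "subgroup stab (AutoGroup (ZxZp p))"
proof -
  interpret A: group "AutoGroup (ZxZp p)" by (rule group.AutoGroup[OF group_ZxZp])
  have car: "carrier (AutoGroup (ZxZp p)) = auto (ZxZp p)" by (simp add: AutoGroup_def)
  have one: "\<one>\<^bsub>AutoGroup (ZxZp p)\<^esub> g = g" if "g \<in> reps" for g
    using that by (simp add: AutoGroup_def BijGroup_def)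
  have into: "\<sigma> g \<in> reps" if "\<sigma> \<in> auto (ZxZp p)" "g \<in> reps" for \<sigma> g
    using that by (auto simp: auto_def hom_def)
  show ?thesis
  proof (rule A.subgroupI)
    show "stab \<subseteq> carrier (AutoGroup (ZxZp p))" by (auto simp: stab_def car)
    have "\<one>\<^bsub>AutoGroup (ZxZp p)\<^esub> \<in> stab" using A.one_closed one by (simp add: stab_def car)
    then show "stab \<noteq> {}" by blast
    fix \<sigma> assume s: "\<sigma> \<in> stab"
    then have sa: "\<sigma> \<in> auto (ZxZp p)" by (simp add: stab_def)
    define \<tau> where "\<tau> = inv\<^bsub>AutoGroup (ZxZp p)\<^esub> \<sigma>"
    have ta: "\<tau> \<in> auto (ZxZp p)" using A.inv_closed sa unfolding \<tau>_def car by blast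
    have "rel g (\<tau> g)" if g: "g \<in> reps" for g
    proof -
      have "\<sigma> \<otimes>\<^bsub>AutoGroup (ZxZp p)\<^esub> \<tau> = \<one>\<^bsub>AutoGroup (ZxZp p)\<^esub>"
        unfolding \<tau>_def using sa by (intro A.r_inv) (simp add: car)
      then have "\<sigma> (\<tau> g) = g" using stab_mult[OF sa ta g] one[OF g] by simp
      moreover have "rel (\<tau> g) (\<sigma> (\<tau> g))" using s into[OF ta g] unfolding stab_def by blast
      ultimately show ?thesis using rel_sym by simp
    qed
    then show "inv\<^bsub>AutoGroup (ZxZp p)\<^esub> \<sigma> \<in> stab" using ta by (simp add: stab_def \<tau>_def)
    fix \<rho> assume r: "\<rho> \<in> stab"
    then have ra: "\<rho> \<in> auto (ZxZp p)" by (simp add: stab_def)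
    have "rel g ((\<sigma> \<otimes>\<^bsub>AutoGroup (ZxZp p)\<^esub> \<rho>) g)" if g: "g \<in> reps" for g
    proof -
      have "rel g (\<rho> g)" "rel (\<rho> g) (\<sigma> (\<rho> g))" using r s g into[OF ra g] unfolding stab_def by blast+
      then show ?thesis using rel_trans stab_mult[OF sa ra g] by simp
    qed
    moreover have "\<sigma> \<otimes>\<^bsub>AutoGroup (ZxZp p)\<^esub> \<rho> \<in> auto (ZxZp p)"
      using A.m_closed[of \<sigma> \<rho>] sa ra by (simp add: car)
    ultimately show "\<sigma> \<otimes>\<^bsub>AutoGroup (ZxZp p)\<^esub> \<rho> \<in> stab" by (simp add: stab_def)
  qed
qed

text \<open>An automorphism preserving all classes is determined by the images of the two generators,
  which lie in finite classes.\<close>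

lemma stab_finite: "finite stab"
proof (rule inj_on_finite)
  define \<phi> where "\<phi> \<sigma> = (\<sigma> (red (1, 0)), \<sigma> (red (0, 1)))" for \<sigma> :: "zz \<Rightarrow> zz"
  have ext: "\<sigma> (red u) = red (scale (fst u) (\<sigma> (red (1, 0))) + scale (snd u) (\<sigma> (red (0, 1))))"
    if s: "\<sigma> \<in> stab" for \<sigma> u
  proof -
    have add: "\<sigma> (red (u + v)) = red (\<sigma> (red u) + \<sigma> (red v))" for u v
    proof -
      have "red (u + v) = red (red u + red v)" by (rule red_add_cong) simp_all
      then show ?thesis using stab_hom[OF s red_in_reps red_in_reps] by simp
    qed
    have red_s: "red (\<sigma> (red u)) = \<sigma> (red u)" for u using stab_reps[OF s red_in_reps] red_id by blast
    have step: "\<sigma> (red (scale n v)) = red (scale n (\<sigma> (red v)))" for n v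
    proof (induction n rule: int_induct[where k = 0])
      case base
      have "scale 0 w = 0" for w by (simp add: scale_def zero_prod_def)
      moreover have "\<sigma> (red 0) = 0"
      proof -
        have "\<sigma> 0 = red (\<sigma> 0 + \<sigma> 0)" using add[of 0 0] by simp
        then have "red (\<sigma> 0 - \<sigma> 0) = red (\<sigma> 0 + \<sigma> 0 - \<sigma> 0)" using red_s[of 0] by (intro red_diff_cong) simp_all
        then show ?thesis using red_s[of 0] by simp
      qed
      ultimately show ?case by simp
    next
      case (step1 i)
      have e: "scale (i + 1) w = scale i w + w" for w by (simp add: scale_def prod_eq_iff distrib_right)
      show ?case unfolding e add step1 by (rule red_add_cong) (simp_all add: red_s)
    next
      case (step2 i)
      have e: "scale i w = scale (i - 1) w + w" for w by (simp add: scale_def prod_eq_iff left_diff_distrib)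
      have "red (scale (i - 1) (\<sigma> (red v)) + \<sigma> (red v)) = red (\<sigma> (red (scale (i - 1) v)) + \<sigma> (red v))"
        using step2 unfolding e[of v] e[of "\<sigma> (red v)"] add by simp
      from red_diff_cong[OF this refl, of "\<sigma> (red v)"] show ?case using red_s by simp
    qed
    have "u = scale (fst u) (1, 0) + scale (snd u) (0, 1)" by (simp add: scale_def prod_eq_iff)
    then have "\<sigma> (red u) = red (\<sigma> (red (scale (fst u) (1, 0))) + \<sigma> (red (scale (snd u) (0, 1))))"
      using add by metis
    also have "\<dots> = red (scale (fst u) (\<sigma> (red (1, 0))) + scale (snd u) (\<sigma> (red (0, 1))))"
      unfolding step by (rule red_add_cong) simp_all
    finally show ?thesis .
  qed
  show "inj_on \<phi> stab"
  proof (rule inj_onI)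
    fix \<sigma> \<tau> assume st: "\<sigma> \<in> stab" "\<tau> \<in> stab" "\<phi> \<sigma> = \<phi> \<tau>"
    have eqG: "\<sigma> g = \<tau> g" if g: "g \<in> reps" for g
      using ext[OF st(1), of g] ext[OF st(2), of g] st(3) red_id[OF g] by (simp add: \<phi>_def)
    have "\<sigma> \<in> extensional reps" "\<tau> \<in> extensional reps" using st by (auto simp: stab_def auto_def Bij_def)
    then show "\<sigma> = \<tau>" using eqG by (rule extensionalityI)
  qed
  show "\<phi> ` stab \<subseteq> cl (1, 0) \<times> cl (0, 1)"
  proof (rule image_subsetI)
    fix \<sigma> assume s: "\<sigma> \<in> stab"
    have "rel (red u) (\<sigma> (red u))" "red (\<sigma> (red u)) = \<sigma> (red u)" for u
      using s red_in_reps stab_reps[OF s red_in_reps] red_id unfolding stab_def by blast+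
    then show "\<phi> \<sigma> \<in> cl (1, 0) \<times> cl (0, 1)" by (auto simp: \<phi>_def cl_iff)
  qed
qed simp

text \<open>A triple (e, a, w) encodes the automorphism that sends (1, 0) to (e, a) and (0, 1) to
  (0, w). \<open>B\<close> merely describes the classes by such maps; the acting group is
  \<open>stab\<close>, which contains them all.\<close>

lemma automorphicI:
  assumes B: "\<And>e a w. (e, a, w) \<in> B \<Longrightarrow> (e = 1 \<or> e = -1) \<and> w \<in> W"
    and r: "\<And>g h. rel g h \<longleftrightarrow> (\<exists>(e, a, w)\<in>B. red h = red (e * fst g, a * fst g + w * snd g))"
  shows "automorphic (ZxZp p) (span_classes D :: (zz \<Rightarrow> 'f::field_char_0) set)"
proof -
  have trans: "\<exists>\<sigma>\<in>stab. \<sigma> g = h" if gh: "g \<in> reps" "h \<in> reps" "rel g h" for g h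
  proof -
    from r gh(3) obtain e a w where b: "(e, a, w) \<in> B" "red h = red (e * fst g, a * fst g + w * snd g)" by blast
    define s where "s u = (e * fst u, a * fst u + w * snd u)" for u :: zz
    have e: "e * e = 1" using B[OF b(1)] by auto
    have "coprime w (int p)"
    proof -
      have "w > 0" "w < int p" using B[OF b(1)] W_sub by auto
      then have "\<not> int p dvd w" using zdvd_not_zless by blast
      moreover have "Factorial_Ring.prime (int p)" using prime_p by simp
      ultimately show ?thesis by (metis coprime_commute prime_imp_coprime)
    qed
    then obtain w' c' where w': "w' * w + c' * int p = 1" using bezout_int[of w "int p"] by auto
    \<comment> \<open>The inverse of \<open>s\<close> modulo (0, p): e is its own inverse and w'
      inverts w modulo p.\<close>
    define s' where "s' u = (e * fst u, w' * (snd u - a * e * fst u))" for u :: zz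
    have s_cong: "red u = red v \<Longrightarrow> red (s u) = red (s v)" for u v
      by (auto simp: red_eq_iff s_def right_diff_distrib[symmetric])
    have s'_cong: "red u = red v \<Longrightarrow> red (s' u) = red (s' v)" for u v
      by (auto simp: red_eq_iff s'_def right_diff_distrib[symmetric])
    have ss': "red (s (s' u)) = red u" "red (s' (s u)) = red u" for u
    proof -
      have 1: "w * w' * t - t = int p * (- c' * t)" for t
        using arg_cong[OF w', of "\<lambda>y. y * t"] by (simp add: algebra_simps)
      have "a * (e * fst u) + w * (w' * (snd u - a * e * fst u)) - snd u
         = w * w' * (snd u - a * e * fst u) - (snd u - a * e * fst u)" by (simp add: algebra_simps)
      also have "int p dvd \<dots>" unfolding 1 by simp
      finally show "red (s (s' u)) = red u" using e by (simp add: red_eq_iff s_def s'_def mult.assoc[symmetric])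
      have ee: "a * e * (e * fst u) = a * fst u" using e by (metis mult.assoc mult.left_neutral)
      have "w' * (a * fst u + w * snd u - a * e * (e * fst u)) - snd u = w * w' * snd u - snd u"
        unfolding ee by (simp add: algebra_simps)
      also have "int p dvd \<dots>" unfolding 1 by simp
      finally show "red (s' (s u)) = red u" using e by (simp add: red_eq_iff s_def s'_def mult.assoc[symmetric])
    qed
    define \<sigma> where "\<sigma> = restrict (\<lambda>u. red (s u)) reps"
    have "bij_betw (\<lambda>u. red (s u)) reps reps"
    proof (rule bij_betw_byWitness[where f' = "\<lambda>u. red (s' u)"])
      show "\<forall>u\<in>reps. red (s' (red (s u))) = u" using s'_cong[OF red_red] ss'(2) red_id by metis
      show "\<forall>u\<in>reps. red (s (red (s' u))) = u" using s_cong[OF red_red] ss'(1) red_id by metis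
    qed auto
    then have "bij_betw \<sigma> reps reps" unfolding \<sigma>_def by (rule bij_betw_cong[THEN iffD1, rotated]) simp
    moreover have "\<sigma> \<in> hom (ZxZp p) (ZxZp p)"
    proof (rule homI)
      fix u v assume "u \<in> carrier (ZxZp p)" "v \<in> carrier (ZxZp p)"
      then have uv: "u \<in> reps" "v \<in> reps" by simp_all
      have "s (u + v) = s u + s v" by (simp add: s_def prod_eq_iff algebra_simps)
      then have "red (s (red (u + v))) = red (red (s u) + red (s v))"
        using s_cong[OF red_red, of "u + v"] red_add_cong[of "red (s u)" "s u" "red (s v)" "s v"] by simp
      then show "\<sigma> (u \<otimes>\<^bsub>ZxZp p\<^esub> v) = \<sigma> u \<otimes>\<^bsub>ZxZp p\<^esub> \<sigma> v" using uv by (simp add: \<sigma>_def)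
    qed (simp add: \<sigma>_def)
    ultimately have "\<sigma> \<in> auto (ZxZp p)" by (simp add: auto_def Bij_def \<sigma>_def)
    moreover have "rel u (\<sigma> u)" if "u \<in> reps" for u
      using r[of u "s u"] b(1) that by (auto simp: \<sigma>_def s_def)
    ultimately have "\<sigma> \<in> stab" by (simp add: stab_def)
    moreover have "\<sigma> g = h" using b(2) gh(1) red_id[OF gh(2)] by (simp add: \<sigma>_def s_def)
    ultimately show ?thesis by blast
  qed
  have "(span_classes D :: (zz \<Rightarrow> 'f) set) = fixed_alg (ZxZp p) stab"
  proof (intro equalityI subsetI)
    fix x :: "zz \<Rightarrow> 'f" assume "x \<in> span_classes D"
    then have x: "finite (gsupp x)" "gsupp x \<subseteq> reps" "\<And>g h. g \<in> reps \<Longrightarrow> h \<in> reps \<Longrightarrow> rel g h \<Longrightarrow> x g = x h"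
      unfolding span_classes_eq by blast+
    have "x (\<sigma> g) = x g" if "\<sigma> \<in> stab" "g \<in> reps" for \<sigma> g
    proof -
      have "rel g (\<sigma> g)" using that by (simp add: stab_def)
      then show ?thesis using x(3)[OF that(2) stab_reps[OF that]] by simp
    qed
    then show "x \<in> fixed_alg (ZxZp p) stab" using x(1,2) by (simp add: fixed_alg_def grp_alg_def)
  next
    fix x :: "zz \<Rightarrow> 'f" assume "x \<in> fixed_alg (ZxZp p) stab"
    then have x: "finite (gsupp x)" "gsupp x \<subseteq> reps" "\<And>\<sigma> g. \<sigma> \<in> stab \<Longrightarrow> g \<in> reps \<Longrightarrow> x (\<sigma> g) = x g"
      by (simp_all add: fixed_alg_def grp_alg_def)
    have "x g = x h" if "g \<in> reps" "h \<in> reps" "rel g h" for g h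
      using trans[OF that] x(3) that(1) by metis
    then show "x \<in> span_classes D" unfolding span_classes_eq using x(1,2) by blast
  qed
  then show ?thesis unfolding automorphic_def using stab_subgroup stab_finite by blast
qed

lemma automorphic_of_coprime_class:
  assumes "coprime (card (cl c)) m" "\<not> int p dvd fst c" "proper_layer 1"
  shows "automorphic (ZxZp p) (span_classes D :: (zz \<Rightarrow> 'f::field_char_0) set)"
proof -
  obtain x where x: "fst x = 1" "slice_card (cl x) 1 = 1" using layer1_singleton[OF assms] .
  define j where "j = snd x"
  \<comment> \<open>The map fixing x = (1, j) and multiplying Z_p by w sends (1, 0) = x - (0, j) to
    (1, j - w j).\<close>
  have e1: "scale (fst g) x + (0, w * snd (g - scale (fst g) x)) = (1 * fst g, (j - w * j) * fst g + w * snd g)" for g w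
    using x(1) by (simp add: prod_eq_iff j_def algebra_simps)
  show ?thesis
  proof (cases "layer_rel 1 (-1)")
    case False
    define B where "B = (\<lambda>w. (1::int, j - w * j, w)) ` W"
    have r: "rel g h \<longleftrightarrow> (\<exists>(e, a, w)\<in>B. red h = red (e * fst g, a * fst g + w * snd g))" for g h
      unfolding rel_one_sided[OF x False] e1 B_def by auto
    show ?thesis
      by (rule automorphicI[OF _ r]) (auto simp: B_def)
  next
    case True
    have "fst c \<noteq> 0" using assms(2) by auto
    from rel_two_sided[OF x True odd_m[OF assms(1) this True]] obtain d where d:
      "\<And>g h. rel g h \<longleftrightarrow> (\<exists>w\<in>W.
      red h = red (scale (fst g) x + (0, w * snd (g - scale (fst g) x))) \<or>
      red h = red (scale (- fst g) x + (0, fst g * d + w * snd (g - scale (fst g) x))))" by blast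
    \<comment> \<open>The same computation for the map that sends x to its partner x^(-1)
      a^d.\<close>
    have e2: "scale (- fst g) x + (0, fst g * d + w * snd (g - scale (fst g) x))
        = (-1 * fst g, (d - j - w * j) * fst g + w * snd g)" for g w
      using x(1) by (simp add: prod_eq_iff j_def algebra_simps)
    define B where "B = (\<lambda>w. (1::int, j - w * j, w)) ` W \<union> (\<lambda>w. (-1::int, d - j - w * j, w)) ` W"
    have r: "rel g h \<longleftrightarrow> (\<exists>(e, a, w)\<in>B. red h = red (e * fst g, a * fst g + w * snd g))" for g h
      unfolding d e1 e2 B_def bex_Un by auto
    show ?thesis
      by (rule automorphicI[OF _ r]) (auto simp: B_def)
  qed
qed

text \<open>The hypothesis on c is conditional because the p-th powers are shown to form an
  S-subgroup when all layers are proper; otherwise the wedge case applies.\<close>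

theorem wedge_or_automorphic:
  assumes "coprime (card (cl c)) m" and "\<And>i. S_subgroup (ZxZp p) D (range (\<lambda>i. (int p * i, 0))) \<Longrightarrow> fst c \<noteq> int p * i"
  shows "wedge_product (ZxZp p) D \<or> automorphic (ZxZp p) (span_classes D :: (zz \<Rightarrow> 'f::field_char_0) set)"
proof (cases "\<forall>i. proper_layer i")
  case True
  then have "S_subgroup (ZxZp p) D (range (\<lambda>i. (int p * i, 0)))" by (intro S_subgroup_p_mult) blast
  then have "\<not> int p dvd fst c" using assms(2) by (auto elim!: dvdE)
  then show ?thesis using automorphic_of_coprime_class[OF assms(1)] True by blast
next
  case False
  then show ?thesis using wedge_if_full by blast
qed

end

section \<open>From the definitions to the class data\<close>

context modp begin

lemma carrier_Zp [simp]: "carrier (Zp p) = {0..<int p}"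
  using p_nz by (simp add: Zp_def carrier_integer_mod_group)

lemma auto_Zp_eq:
  assumes "f \<in> auto (Zp p)" "j \<in> {0..<int p}"
  shows "f j = f 1 * j mod int p"
proof -
  have into: "f i \<in> {0..<int p}" if "i \<in> {0..<int p}" for i
    using assms(1) that by (auto simp: auto_def hom_def)
  have add: "f ((i + k) mod int p) = (f i + f k) mod int p" if "i \<in> {0..<int p}" "k \<in> {0..<int p}" for i k
    using assms(1) that by (auto simp: auto_def hom_def Zp_def carrier_integer_mod_group)
  have "f (int n) = f 1 * int n mod int p" if "int n < int p" for n
    using that
  proof (induction n)
    case 0
    have "f 0 mod int p = f 0" using into[of 0] by simp
    moreover have "f 0 = (f 0 + f 0) mod int p" using add[of 0 0] by simp
    ultimately have "int p dvd f 0" by (metis add_diff_cancel_right' mod_eq_dvd_iff)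
    then show ?case using into[of 0] zdvd_not_zless[of "f 0" "int p"] by fastforce
  next
    case (Suc n)
    have "f (int (Suc n)) = f ((int n + 1) mod int p)" using Suc.prems by (simp add: add.commute)
    also have "\<dots> = (f (int n) + f 1) mod int p" using Suc.prems p_gt1 by (intro add) auto
    also have "\<dots> = f 1 * int (Suc n) mod int p"
      using Suc by (simp add: algebra_simps mod_simps)
    finally show ?case .
  qed
  from this[of "nat j"] show ?thesis using assms(2) by simp
qed

text \<open>The point where the field is left: both sides of \<open>D_prod\<close> become values of
  one convolution, and characteristic 0 makes \<open>of_nat\<close> injective.\<close>

lemma conv_bar:
  assumes "finite C" "C \<subseteq> reps" "C' \<subseteq> reps" "g \<in> reps"
  shows "conv (ZxZp p) (bar C) (bar C') g
    = (of_nat (card {w\<in>C \<times> C'. red (fst w + snd w) = g}) :: 'f::field_char_0)"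
proof -
  have supp: "gsupp (bar C :: zz \<Rightarrow> 'f) = C" by (auto simp: gsupp_def bar_def)
  have i: "red (red (- h) + g) = red (g - h)" for h
    using red_add_cong[of "red (- h)" "- h" g g] by simp
  have "conv (ZxZp p) (bar C) (bar C') g = (\<Sum>h\<in>C. if red (g - h) \<in> C' then 1 else (0::'f))"
    unfolding conv_def supp using assms(2,4) i by (auto simp: bar_def intro!: sum.cong)
  also have "\<dots> = of_nat (card {h\<in>C. red (g - h) \<in> C'})"
    using assms(1) by (simp add: sum.If_cases Int_def)
  also have "card {h\<in>C. red (g - h) \<in> C'} = card {w\<in>C \<times> C'. red (fst w + snd w) = g}"
  proof (rule bij_betw_same_card[of "\<lambda>h. (h, red (g - h))"], rule bij_betw_byWitness[where f' = fst])
    have "red (h + red (g - h)) = g" for h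
      using red_add_cong[of h h "red (g - h)" "g - h"] red_id[OF assms(4)] by simp
    then show "(\<lambda>h. (h, red (g - h))) ` {h\<in>C. red (g - h) \<in> C'} \<subseteq> {w\<in>C \<times> C'. red (fst w + snd w) = g}"
      by auto
    have k: "red (g - h) = h'" if "red (h + h') = g" "h' \<in> reps" for h h'
    proof -
      have "red (g - h) = red (h + h' - h)" using that(1) by (intro red_diff_cong) auto
      then show ?thesis using red_id[OF that(2)] by simp
    qed
    show "\<forall>w\<in>{w\<in>C \<times> C'. red (fst w + snd w) = g}. (fst w, red (g - fst w)) = w"
      using k assms(3) by (auto simp: prod_eq_iff[of _ "(_, _)"])
    show "fst ` {w\<in>C \<times> C'. red (fst w + snd w) = g} \<subseteq> {h\<in>C. red (g - h) \<in> C'}"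
    proof (rule image_subsetI)
      fix w assume "w \<in> {w\<in>C \<times> C'. red (fst w + snd w) = g}"
      then have w: "fst w \<in> C" "snd w \<in> C'" "red (fst w + snd w) = g" by auto
      then show "fst w \<in> {h\<in>C. red (g - h) \<in> C'}" using k[OF w(3)] assms(3) by auto
    qed
  qed simp
  finally show ?thesis .
qed

end

lemma span_classes_const:
  assumes "x \<in> span_classes D" "\<And>C C'. C \<in> D \<Longrightarrow> C' \<in> D \<Longrightarrow> C \<noteq> C' \<Longrightarrow> C \<inter> C' = {}"
    and "E \<in> D" "g \<in> E" "h \<in> E"
  shows "(x g :: 'f::field) = x h"
proof -
  obtain F c where F: "F \<subseteq> D" "x = (\<lambda>g. \<Sum>e\<in>F. c e * bar e g)"
    using assms(1) unfolding span_classes_def by blast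
  have "(bar e g :: 'f) = bar e h" if "e \<in> F" for e
    using assms(2)[of e E] assms(3-5) that F(1) by (cases "e = E") (auto simp: bar_def)
  then show ?thesis unfolding F(2) by (intro sum.cong) simp_all
qed

lemma bar_in_span: "C \<in> D \<Longrightarrow> (bar C :: 'a \<Rightarrow> 'f::field) \<in> span_classes D"
  unfolding span_classes_def by (intro CollectI exI[of _ "{C}"] exI[of _ "\<lambda>_. 1"]) simp

context modp begin

lemma schur_ring_locale:
  fixes S :: "(zz \<Rightarrow> 'f::field_char_0) set"
  assumes sr: "schur_ring (ZxZp p) S D" and Hc: "subgroup Hc (AutoGroup (Zp p))"
    and T: "S \<inter> {x \<in> grp_alg (ZxZp p). gsupp x \<subseteq> {0} \<times> UNIV} = embZp ` fixed_alg (Zp p) Hc"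
  shows "zp_schur p D ((\<lambda>f. f 1) ` Hc)"
proof -
  have D: "\<And>C. C \<in> D \<Longrightarrow> C \<noteq> {} \<and> finite C \<and> C \<subseteq> reps"
      "\<And>C C'. C \<in> D \<Longrightarrow> C' \<in> D \<Longrightarrow> C \<noteq> C' \<Longrightarrow> C \<inter> C' = {}"
      "\<Union>D = reps" "{0} \<in> D" "\<And>C. C \<in> D \<Longrightarrow> (\<lambda>g. inv\<^bsub>ZxZp p\<^esub> g) ` C \<in> D"
      "S = span_classes D"
      "\<And>C C'. C \<in> D \<Longrightarrow> C' \<in> D \<Longrightarrow> conv (ZxZp p) (bar C) (bar C') \<in> S"
    using sr unfolding schur_ring_def carrier_ZxZp one_ZxZp by blast+
  have const: "x g = x h" if "x \<in> S" "E \<in> D" "g \<in> E" "h \<in> E" for x E g h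
    using span_classes_const[OF _ D(2) that(2-4)] that(1) unfolding D(6) by blast
  interpret H: subgroup Hc "AutoGroup (Zp p)" by (rule Hc)
  have gZp: "group (Zp p)" by (simp add: Zp_def)
  have sub: "f \<in> auto (Zp p)" if "f \<in> Hc" for f using H.subset that by (auto simp: AutoGroup_def)
  have into: "f j \<in> {0..<int p}" if "f \<in> Hc" "j \<in> {0..<int p}" for f j
    using sub[OF that(1)] that(2) by (auto simp: auto_def hom_def)
  have fj: "f j = f 1 * j mod int p" if "f \<in> Hc" "j \<in> {0..<int p}" for f j
    using auto_Zp_eq[OF sub[OF that(1)] that(2)] .
  have comp: "\<exists>k\<in>Hc. \<forall>j\<in>{0..<int p}. k j = f (g j)" if "f \<in> Hc" "g \<in> Hc" for f g
    using H.m_closed[OF that] sub that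
    by (intro bexI[of _ "f \<otimes>\<^bsub>AutoGroup (Zp p)\<^esub> g"]) (simp_all add: AutoGroup_def BijGroup_def auto_def compose_def)
  have idH: "\<exists>k\<in>Hc. \<forall>j\<in>{0..<int p}. k j = j"
    using H.one_closed by (intro bexI[of _ "\<one>\<^bsub>AutoGroup (Zp p)\<^esub>"]) (simp_all add: AutoGroup_def BijGroup_def)
  have inv: "\<exists>k\<in>Hc. \<forall>j\<in>{0..<int p}. k (f j) = j" if f: "f \<in> Hc" for f
  proof -
    interpret A: group "AutoGroup (Zp p)" by (rule group.AutoGroup[OF gZp])
    let ?k = "inv\<^bsub>AutoGroup (Zp p)\<^esub> f"
    have k: "?k \<in> Hc" using f by (rule H.m_inv_closed)
    have e: "?k \<otimes>\<^bsub>AutoGroup (Zp p)\<^esub> f = \<one>\<^bsub>AutoGroup (Zp p)\<^esub>" using f by (intro A.l_inv) (rule H.mem_carrier)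
    have "?k (f j) = j" if "j \<in> {0..<int p}" for j
      using fun_cong[OF e, of j] sub[OF k] sub[OF f] that
      by (simp add: AutoGroup_def BijGroup_def auto_def compose_def)
    then show ?thesis using k by blast
  qed
  \<comment> \<open>The orbit of j is the class E of (0, j). The orbit sum is fixed by
    \<open>Hc\<close>, hence lies in S and is constant on E, so E is inside the orbit. Then the sum
    of E lives over Z_p and is itself fixed by \<open>Hc\<close>, so E contains the orbit.\<close>
  have orb: "(\<lambda>f. (0, f j)) ` Hc \<in> D" if j: "j \<in> {0..<int p}" for j
  proof -
    define O1 where "O1 = (\<lambda>f. f j) ` Hc"
    have O1: "O1 \<subseteq> {0..<int p}" using into j by (auto simp: O1_def)
    have "(0, j) \<in> \<Union>D" using j unfolding D(3) reps_def by simp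
    then obtain E where E: "E \<in> D" "(0, j) \<in> E" by blast
    have inO: "\<sigma> g \<in> O1 \<longleftrightarrow> g \<in> O1" if s: "\<sigma> \<in> Hc" and g: "g \<in> {0..<int p}" for \<sigma> g
    proof
      assume "\<sigma> g \<in> O1"
      then obtain f where f: "f \<in> Hc" "\<sigma> g = f j" by (auto simp: O1_def)
      obtain k where k: "k \<in> Hc" "k (\<sigma> g) = g" using inv[OF s] g by blast
      obtain l where "l \<in> Hc" "l j = k (f j)" using comp[OF k(1) f(1)] j by blast
      then show "g \<in> O1" using k(2) f(2) unfolding O1_def by (metis imageI)
    next
      assume "g \<in> O1"
      then obtain f where f: "f \<in> Hc" "g = f j" by (auto simp: O1_def)
      obtain l where "l \<in> Hc" "l j = \<sigma> (f j)" using comp[OF s f(1)] j by blast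
      then show "\<sigma> g \<in> O1" using f(2) unfolding O1_def by (metis imageI)
    qed
    have "(bar O1 :: int \<Rightarrow> 'f) \<in> fixed_alg (Zp p) Hc"
    proof -
      have "gsupp (bar O1 :: int \<Rightarrow> 'f) = O1" by (auto simp: gsupp_def bar_def)
      moreover have "finite O1" using O1 finite_subset by blast
      ultimately show ?thesis using O1 inO by (simp add: fixed_alg_def grp_alg_def bar_def)
    qed
    then have "(embZp (bar O1) :: zz \<Rightarrow> 'f) \<in> S" using T by blast
    moreover obtain k where "k \<in> Hc" "j = k j" using idH j by auto
    then have "j \<in> O1" unfolding O1_def by blast
    then have "(embZp (bar O1) :: zz \<Rightarrow> 'f) (0, j) = 1" by (simp add: embZp_def bar_def)
    ultimately have e1: "(embZp (bar O1) :: zz \<Rightarrow> 'f) u = 1" if "u \<in> E" for u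
      using const[OF _ E(1) that E(2)] by metis
    have EO: "E \<subseteq> {0} \<times> O1"
    proof
      fix u assume "u \<in> E"
      from e1[OF this] show "u \<in> {0} \<times> O1" by (cases u) (auto simp: embZp_def bar_def split: if_splits)
    qed
    have "gsupp (bar E :: zz \<Rightarrow> 'f) = E" by (auto simp: gsupp_def bar_def)
    then have "(bar E :: zz \<Rightarrow> 'f) \<in> S \<inter> {x \<in> grp_alg (ZxZp p). gsupp x \<subseteq> {0} \<times> UNIV}"
      using bar_in_span[OF E(1), where 'f = 'f] D(1)[OF E(1)] EO D(6) by (auto simp: grp_alg_def)
    then obtain y :: "int \<Rightarrow> 'f" where y: "y \<in> fixed_alg (Zp p) Hc" "bar E = embZp y" using T by blast
    have "(0, f j) \<in> E" if f: "f \<in> Hc" for f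
    proof -
      have "y (f j) = y j" using y(1) f j by (simp add: fixed_alg_def)
      then have "(bar E :: zz \<Rightarrow> 'f) (0, f j) = bar E (0, j)" by (simp add: y(2) embZp_def)
      then show ?thesis using E(2) by (simp add: bar_def split: if_splits)
    qed
    then have "(\<lambda>f. (0, f j)) ` Hc = E" using EO unfolding O1_def by auto
    then show ?thesis using E(1) by simp
  qed
  show ?thesis
  proof (unfold_locales)
    fix C assume C: "C \<in> D"
    show "finite C" "C \<noteq> {}" using D(1)[OF C] by auto
    have "(\<lambda>g. inv\<^bsub>ZxZp p\<^esub> g) ` C = (\<lambda>u. red (- u)) ` C"
      using D(1)[OF C] by (intro image_cong) auto
    then show "(\<lambda>u. red (- u)) ` C \<in> D" using D(5)[OF C] by simp
  next
    fix C C' u assume "C \<in> D" "C' \<in> D" "u \<in> C" "u \<in> C'"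
    then show "C = C'" using D(2) by blast
  next
    show "\<Union>D = reps" "{0} \<in> D" using D by auto
  next
    fix C C' E g h assume *: "C \<in> D" "C' \<in> D" "E \<in> D" "g \<in> E" "h \<in> E"
    then have "g \<in> reps" "h \<in> reps" using D(1) by blast+
    with const[OF D(7)[OF *(1,2)] *(3-5)] D(1)[OF *(1)] D(1)[OF *(2)]
    show "card {w\<in>C \<times> C'. red (fst w + snd w) = g} = card {w\<in>C \<times> C'. red (fst w + snd w) = h}"
      by (simp add: conv_bar)
  next
    show "(\<lambda>f. f 1) ` Hc \<subseteq> {1..<int p}"
    proof (rule image_subsetI)
      fix f assume f: "f \<in> Hc"
      have b: "inj_on f {0..<int p}" using sub[OF f] by (auto simp: auto_def Bij_def bij_betw_def)
      have "f 0 = 0" using fj[OF f, of 0] by simp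
      then have "f 1 \<noteq> 0" using inj_onD[OF b, of 1 0] p_gt1 by auto
      moreover have "f 1 \<in> {0..<int p}" using into[OF f] p_gt1 by simp
      ultimately show "f 1 \<in> {1..<int p}" by simp
    qed
    obtain k where "k \<in> Hc" "1 = k 1" using idH p_gt1 by auto
    then show "1 \<in> (\<lambda>f. f 1) ` Hc" by blast
  next
    fix j
    have "red (0, f 1 * j) = (0, f (j mod int p))" if "f \<in> Hc" for f
      using fj[OF that, of "j mod int p"] by (simp add: red_def mod_mult_right_eq)
    then have "(\<lambda>w. red (0, w * j)) ` (\<lambda>f. f 1) ` Hc = (\<lambda>f. (0, f (j mod int p))) ` Hc"
      unfolding image_image by (intro image_cong) auto
    then show "(\<lambda>w. red (0, w * j)) ` (\<lambda>f. f 1) ` Hc \<in> D" using orb[of "j mod int p"] by simp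
  qed
qed

text \<open>An automorphism is determined by its value at the generator, so the number of
  multipliers is the order of \<open>Hc\<close>.\<close>

lemma card_image_1:
  assumes "subgroup Hc (AutoGroup (Zp p))"
  shows "card ((\<lambda>f. f 1) ` Hc) = card Hc"
proof (rule card_image, rule inj_onI)
  fix f g assume fg: "f \<in> Hc" "g \<in> Hc" "f 1 = g 1"
  then have a: "f \<in> auto (Zp p)" "g \<in> auto (Zp p)"
    using subgroup.subset[OF assms] by (auto simp: AutoGroup_def)
  then have "f \<in> extensional {0..<int p}" "g \<in> extensional {0..<int p}" by (simp_all add: auto_def Bij_def)
  moreover have "f j = g j" if "j \<in> {0..<int p}" for j
    using auto_Zp_eq[OF a(1) that] auto_Zp_eq[OF a(2) that] fg(3) by simp
  ultimately show "f = g" by (rule extensionalityI)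
qed

end

theorem theorem3p7:
  fixes p :: nat
    and S :: "(int \<times> int \<Rightarrow> 'f::field_char_0) set"
    and D :: "(int \<times> int) set set"
    and H :: "(int \<times> int) set"
    and Hc :: "(int \<Rightarrow> int) set"
    and C :: "(int \<times> int) set"
  assumes "Factorial_Ring.prime p"
    and "schur_ring (ZxZp p) S D"
    and "S_subgroup (ZxZp p) D H" and "H \<subseteq> UNIV \<times> {0}"
    and "\<And>K. S_subgroup (ZxZp p) D K \<Longrightarrow> K \<subseteq> UNIV \<times> {0} \<Longrightarrow> K \<subseteq> H"
    and "subgroup Hc (AutoGroup (Zp p))"
    and "S \<inter> {x \<in> grp_alg (ZxZp p). gsupp x \<subseteq> {0} \<times> UNIV} = embZp ` fixed_alg (Zp p) Hc"
    and "C \<in> D"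
    and "C \<subseteq> carrier (ZxZp p) - {(i, j). (i, 0) \<in> H \<and> j \<in> carrier (Zp p)}"
    and "coprime (card C) (card Hc)"
  shows "wedge_product (ZxZp p) D \<or> automorphic (ZxZp p) S"
proof -
  interpret modp p by unfold_locales (rule assms(1))
  interpret zp_schur p D "(\<lambda>f. f 1) ` Hc"
    by (rule schur_ring_locale[OF assms(2,6,7)])
  obtain c where c: "c \<in> C" using D_ne[OF assms(8)] by blast
  have Cc: "C = cl c" by (rule D_cl[OF assms(8) c])
  have c': "c \<in> reps" "(fst c, 0) \<notin> H" using assms(9) c by (auto simp: reps_def)
  have "coprime (card (cl c)) (card ((\<lambda>f. f 1) ` Hc))"
    using assms(10) card_image_1[OF assms(6)] by (simp add: Cc)
  \<comment> \<open>The p-th powers lie in Z, so maximality puts them into H, while c lies outside H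
    x Z_p.\<close>
  moreover have "fst c \<noteq> int p * i" if "S_subgroup (ZxZp p) D (range (\<lambda>i. (int p * i, 0)))" for i
  proof -
    have "range (\<lambda>i. (int p * i, 0)) \<subseteq> H" by (rule assms(5)[OF that]) auto
    then show ?thesis using c'(2) by auto
  qed
  moreover have "S = span_classes D" using assms(2) by (simp add: schur_ring_def)
  ultimately show ?thesis using wedge_or_automorphic[of c, where 'f = 'f] by simp
qed

end
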